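(* Let $q$ be a prime power. With the maps $T:\otimes_{\varphi\in\Theta}\Lambda_{\mathbb C}(Y^\varphi)\to\otimes_{f\in\Phi}\Lambda_{\mathbb C}(X_f)$ (transformation from the basis $\{S_{\bm\lambda}\}$ to the basis $\{\tilde P_{\bm\mu}\}$), $\rho:\otimes_{\varphi\in\Theta}\Lambda_{\mathbb C}(Y^\varphi)\to\Lambda_{\mathbb C}(Y)$ (plethysm map), $\Pi:\otimes_{f\in\Phi}\Lambda_{\mathbb C}(X_f)\to\Lambda_{\mathbb C}(X_{x-1})$ (projection), $\omega:\Lambda_{\mathbb C}(Y)\to\Lambda_{\mathbb C}(Y)$ and $t:\Lambda_{\mathbb C}(Y)\to\Lambda_{\mathbb C}(X_{x-1})$ (change of variables) described in the context, the square commutes: $$\Pi\circ T = t\circ\omega\circ\rho .$$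
   Context: $\mathbb F_q$ is the field with $q$ elements, $\bar{\mathbb F}_q$ its algebraic closure. For a set $Z$ of infinitely many variables, $\Lambda_{\mathbb C}(Z)$ is the ring of symmetric functions in $Z$ over $\mathbb C$, with complete functions $h_r$, elementary functions $e_r$, power sums $p_r$, Schur functions $s_\lambda$; $Y=\{y_1,y_2,\ldots\}$. $P_\lambda(Z;t)$ is the Hall-Littlewood symmetric function (Macdonald's normalization), and with $n(\lambda)=\sum_{i\ge1}(i-1)\lambda_i$ put $\tilde P_\lambda(Z;q)=q^{-n(\lambda)}P_\lambda(Z;q^{-1})$. $F:z\mapsto z^q$ is the Frobenius. $\Phi$ is the set of $F$-orbits in $\bar{\mathbb F}_q^\times$, identified with the monic irreducible polynomials $f\neq x$ in $\mathbb F_q[x]$; $d(f)=\deg f$; $f_z\in\Phi$ is the orbit of $z$; the polynomial $x-1$ corresponds to the orbit $\{1\}$. Let $M_n=\mathbb F_{q^n}^\times$ and $\hat M_n=\mathrm{Hom}(M_n,\mathbb C^\times)$; for $m\mid n$ embed $\hat M_m\subset\hat M_n$ by composing with the norm $M_n\to M_m$. $\Theta$ is the set of orbits of $\xi\mapsto\xi^q$ on $\bigcup_n\hat M_n$; $d(\varphi)=\deg(\varphi)=|\varphi|$. If $\xi\in\varphi$ and $d(\varphi)\mid n$ then $\xi\in\hat M_n$ and $\xi(z)$, $z\in M_n$, is its value there. For $f\in\Phi$ let $X_f=\{X_{1,f},X_{2,f},\ldots\}$ and for $\varphi\in\Theta$ let $Y^\varphi=\{Y^\varphi_1,Y^\varphi_2,\ldots\}$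 be infinite sets of variables. For finitely supported partition-valued functions $\bm\mu$ on $\Phi$ and $\bm\lambda$ on $\Theta$, $\tilde P_{\bm\mu}=\prod_f\tilde P_{\bm\mu(f)}(X_f;q^{d(f)})$ and $S_{\bm\lambda}=\prod_\varphi s_{\bm\lambda(\varphi)}(Y^\varphi)$; these form $\mathbb C$-bases of $\otimes_f\Lambda_{\mathbb C}(X_f)$ and $\otimes_\varphi\Lambda_{\mathbb C}(Y^\varphi)$ respectively. $T$ is the $\mathbb C$-algebra map (expressing symmetric functions in the variables $Y^\varphi$ through those in the variables $X_f$) given by $T(p_k(Y^\varphi))=(-1)^{n-1}\sum_{z\in M_n}\xi(z)\,p_{n/d(f_z)}(X_{f_z})$, where $\xi\in\varphi$ and $n=k\,d(\varphi)$. $\rho$ is the $\mathbb C$-algebra homomorphism with $\rho(h_a(Y^\varphi))=h_a[p_b]:=h_a(y_1^b,y_2^b,\ldots)$, $b=d(\varphi)$. $\Pi$ is the projection onto $\Lambda_{\mathbb C}(X_{x-1})$: the $\mathbb C$-algebra homomorphism that is the identity on $\Lambda_{\mathbb C}(X_{x-1})$ and sends $p_r(X_f)$ to $0$ for all $r\ge1$, $f\neq x-1$. $\omega$ is the $\mathbb C$-algebra homomorphism of $\Lambda_{\mathbb C}(Y)$ with $\omega(e_r(Y))=h_r(Y)$ for all $r\ge0$. $t$ is the map replacing each $y_i$ by $X_{i,x-1}$. *)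

theory Defs
  imports
    "HOL-Algebra.Algebraic_Closure_Type"
    "HOL-Combinatorics.Permutations"
    "HOL-Library.Cardinality"
    "HOL-Library.Multiset"
    Complex_Main
begin

section \<open>Formal power series in arbitrarily many variables\<close>

text \<open>A monomial in the variables \<open>'v\<close> is a finite multiset of variables; a series assigns a complex
  coefficient to every monomial.\<close>

typedef 'v mv_series = "UNIV :: ('v multiset \<Rightarrow> complex) set"
  morphisms mcoeff MSeries ..

setup_lifting type_definition_mv_series

lemma mv_series_eqI: "(\<And>m. mcoeff f m = mcoeff g m) \<Longrightarrow> f = g"
  by transfer auto

lemma finite_sub_mset: "finite {a. a \<subseteq># (m :: 'v multiset)}"
proof (induction m)
  case (add x m)
  have "a \<in> {a. a \<subseteq># m} \<union> add_mset x ` {a. a \<subseteq># m}" if "a \<subseteq># add_mset x m" for a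
  proof (cases "x \<in># a")
    case True
    then obtain b where "a = add_mset x b" by (meson multi_member_split)
    with that show ?thesis by auto
  next
    case False
    with that show ?thesis by (metis UnI1 diff_single_trivial mem_Collect_eq subset_eq_diff_conv
          add_mset_add_single)
  qed
  then have "{a. a \<subseteq># add_mset x m} \<subseteq> {a. a \<subseteq># m} \<union> add_mset x ` {a. a \<subseteq># m}" by blast
  with add.IH show ?case by (meson finite_UnI finite_imageI finite_subset)
qed simp

lemma finite_mset_splits: "finite {(a, b). a + b = (m :: 'v multiset)}"
proof (rule finite_subset)
  show "{(a, b). a + b = m} \<subseteq> {a. a \<subseteq># m} \<times> {a. a \<subseteq># m}" by auto
qed (use finite_sub_mset in blast)

instantiation mv_series :: (type) comm_ring_1
begin

lift_definition zero_mv_series :: "'a mv_series" is "\<lambda>_. 0" .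
lift_definition one_mv_series :: "'a mv_series" is "\<lambda>m. if m = {#} then 1 else 0" .
lift_definition plus_mv_series :: "'a mv_series \<Rightarrow> 'a mv_series \<Rightarrow> 'a mv_series"
  is "\<lambda>f g m. f m + g m" .
lift_definition minus_mv_series :: "'a mv_series \<Rightarrow> 'a mv_series \<Rightarrow> 'a mv_series"
  is "\<lambda>f g m. f m - g m" .
lift_definition uminus_mv_series :: "'a mv_series \<Rightarrow> 'a mv_series" is "\<lambda>f m. - f m" .
lift_definition times_mv_series :: "'a mv_series \<Rightarrow> 'a mv_series \<Rightarrow> 'a mv_series"
  is "\<lambda>f g m. \<Sum>(a, b) \<in> {(a, b). a + b = m}. f a * g b" .

instance
proof
  fix f g h :: "'a mv_series"
  show "f * g * h = f * (g * h)"
  proof transfer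
    fix f g h :: "'a multiset \<Rightarrow> complex"
    have "(\<Sum>(a, b) \<in> {(a, b). a + b = m}. (\<Sum>(c, d) \<in> {(c, d). c + d = a}. f c * g d) * h b)
        = (\<Sum>(a, b) \<in> {(a, b). a + b = m}. f a * (\<Sum>(c, d) \<in> {(c, d). c + d = b}. g c * h d))" for m
    proof -
      let ?S = "\<lambda>m :: 'a multiset. {(a, b). a + b = m}"
      have "(\<Sum>(a, b) \<in> ?S m. (\<Sum>(c, d) \<in> ?S a. f c * g d) * h b)
          = (\<Sum>x \<in> ?S m. \<Sum>y \<in> ?S (fst x). f (fst y) * g (snd y) * h (snd x))"
        by (simp add: case_prod_unfold sum_distrib_right)
      also have "\<dots> = (\<Sum>(x, y) \<in> Sigma (?S m) (\<lambda>x. ?S (fst x)). f (fst y) * g (snd y) * h (snd x))"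
        by (rule sum.Sigma) (use finite_mset_splits in auto)
      also have "\<dots> = (\<Sum>(x, y) \<in> Sigma (?S m) (\<lambda>x. ?S (snd x)). f (fst x) * (g (fst y) * h (snd y)))"
        by (rule sum.reindex_bij_witness[where
              i = "\<lambda>(x, y). ((fst x + fst y, snd y), (fst x, fst y))" and
              j = "\<lambda>(x, y). ((fst y, snd y + snd x), (snd y, snd x))"])
           (auto simp: ac_simps)
      also have "\<dots> = (\<Sum>x \<in> ?S m. \<Sum>y \<in> ?S (snd x). f (fst x) * (g (fst y) * h (snd y)))"
        by (rule sum.Sigma[symmetric]) (use finite_mset_splits in auto)
      also have "\<dots> = (\<Sum>(a, b) \<in> ?S m. f a * (\<Sum>(c, d) \<in> ?S b. g c * h d))"
        by (simp add: case_prod_unfold sum_distrib_left)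
      finally show ?thesis .
    qed
    then show "(\<lambda>m. \<Sum>(a, b) \<in> {(a, b). a + b = m}. (\<Sum>(c, d) \<in> {(c, d). c + d = a}. f c * g d) * h b)
        = (\<lambda>m. \<Sum>(a, b) \<in> {(a, b). a + b = m}. f a * (\<Sum>(c, d) \<in> {(c, d). c + d = b}. g c * h d))"
      by blast
  qed
  show "f * g = g * f"
  proof transfer
    fix f g :: "'a multiset \<Rightarrow> complex"
    show "(\<lambda>m. \<Sum>(a, b) \<in> {(a, b). a + b = m}. f a * g b)
        = (\<lambda>m. \<Sum>(a, b) \<in> {(a, b). a + b = m}. g a * f b)"
      by (rule ext, rule sum.reindex_bij_witness[where i = prod.swap and j = prod.swap])
         (auto simp: ac_simps)
  qed
  show "1 * f = f"
  proof transfer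
    fix f :: "'a multiset \<Rightarrow> complex"
    have "(\<Sum>(a, b) \<in> {(a, b). a + b = m}. (if a = {#} then 1 else 0) * f b) = f m" for m
    proof -
      have "(\<Sum>(a, b) \<in> {(a, b). a + b = m}. (if a = {#} then 1 else 0) * f b)
          = (\<Sum>(a, b) \<in> {(({#} :: 'a multiset), m)}. (if a = {#} then 1 else 0) * f b)"
        by (rule sum.mono_neutral_right) (use finite_mset_splits in \<open>auto split: if_splits\<close>)
      then show ?thesis by simp
    qed
    then show "(\<lambda>m. \<Sum>(a, b) \<in> {(a, b). a + b = m}. (if a = {#} then 1 else 0) * f b) = f" by blast
  qed
  show "(f + g) * h = f * h + g * h"
    by transfer (auto simp: case_prod_unfold distrib_right sum.distrib)
  show "(0 :: 'a mv_series) \<noteq> 1"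
    by transfer (auto simp: fun_eq_iff)
qed (transfer; simp add: fun_eq_iff ac_simps)+

end

lift_definition const_series :: "complex \<Rightarrow> 'v mv_series" is "\<lambda>c m. if m = {#} then c else 0" .

text \<open>Substitution of monomials for variables, given by its effect \<open>\<theta>\<close> on monomials. It is only
  used for \<open>\<theta>\<close> injective, so that the sum below has at most one term.\<close>

lift_definition subst_monom :: "('v multiset \<Rightarrow> 'w multiset) \<Rightarrow> 'v mv_series \<Rightarrow> 'w mv_series"
  is "\<lambda>\<theta> f m. \<Sum>m' | \<theta> m' = m. f m'" .

definition rename_vars :: "('v \<Rightarrow> 'w) \<Rightarrow> 'v mv_series \<Rightarrow> 'w mv_series" where
  "rename_vars g = subst_monom (image_mset g)"

text \<open>\<open>f(y\<^sub>1, y\<^sub>2, \<dots>) \<mapsto> f(y\<^sub>1\<^sup>b, y\<^sub>2\<^sup>b, \<dots>)\<close>, for \<open>b \<ge> 1\<close>\<close>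

definition power_vars :: "nat \<Rightarrow> 'v mv_series \<Rightarrow> 'v mv_series" where
  "power_vars b = subst_monom (repeat_mset b)"


section \<open>Symmetric functions\<close>

text \<open>The ring of symmetric functions over \<open>\<complex>\<close> in the set of variables \<open>Z\<close>: series of bounded degree
  involving only variables of \<open>Z\<close> and invariant under permutations of \<open>Z\<close>.\<close>

definition sym_fun :: "'v set \<Rightarrow> 'v mv_series set" where
  "sym_fun Z = {f. (\<forall>m. mcoeff f m \<noteq> 0 \<longrightarrow> set_mset m \<subseteq> Z) \<and>
                   (\<exists>D. \<forall>m. mcoeff f m \<noteq> 0 \<longrightarrow> size m \<le> D) \<and>
                   (\<forall>\<sigma> m. \<sigma> permutes Z \<longrightarrow> mcoeff f (image_mset \<sigma> m) = mcoeff f m)}"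

lift_definition sym_h :: "nat \<Rightarrow> 'v set \<Rightarrow> 'v mv_series"
  is "\<lambda>r Z m. if size m = r \<and> set_mset m \<subseteq> Z then 1 else 0" .

lift_definition sym_e :: "nat \<Rightarrow> 'v set \<Rightarrow> 'v mv_series"
  is "\<lambda>r Z m. if size m = r \<and> set_mset m \<subseteq> Z \<and> (\<forall>v. count m v \<le> 1) then 1 else 0" .

text \<open>Power sums are only used for \<open>r \<ge> 1\<close>.\<close>

lift_definition sym_p :: "nat \<Rightarrow> 'v set \<Rightarrow> 'v mv_series"
  is "\<lambda>r Z m. if \<exists>z\<in>Z. m = replicate_mset r z then 1 else 0" .

text \<open>For a family of infinite alphabets indexed by \<open>I\<close>, the \<open>n\<close>-th variable of the alphabet with
  index \<open>i\<close> is \<open>(i, n)\<close>.\<close>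

definition alphabet :: "'i \<Rightarrow> ('i \<times> nat) set" where
  "alphabet i = {i} \<times> UNIV"

text \<open>The (restricted) tensor product over \<open>\<complex>\<close> of the rings \<open>\<Lambda>(alphabet i)\<close>, \<open>i \<in> I\<close>. Since the
  alphabets are disjoint, it is the \<open>\<complex>\<close>-algebra generated by these rings inside the series in all
  variables.\<close>

inductive_set sym_tensor :: "'i set \<Rightarrow> ('i \<times> nat) mv_series set" for I where
  const: "const_series c \<in> sym_tensor I"
| gen: "i \<in> I \<Longrightarrow> f \<in> sym_fun (alphabet i) \<Longrightarrow> f \<in> sym_tensor I"
| add: "f \<in> sym_tensor I \<Longrightarrow> g \<in> sym_tensor I \<Longrightarrow> f + g \<in> sym_tensor I"
| mult: "f \<in> sym_tensor I \<Longrightarrow> g \<in> sym_tensor I \<Longrightarrow> f * g \<in> sym_tensor I"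

text \<open>\<open>\<complex>\<close>-algebra homomorphisms between subalgebras \<open>A\<close>, \<open>B\<close>. Compatibility with \<open>const_series\<close>
  gives both the unit law and \<open>\<complex>\<close>-linearity.\<close>

definition calg_hom ::
  "'v mv_series set \<Rightarrow> 'w mv_series set \<Rightarrow> ('v mv_series \<Rightarrow> 'w mv_series) \<Rightarrow> bool" where
  "calg_hom A B h \<longleftrightarrow> h \<in> A \<rightarrow> B \<and>
     (\<forall>c. h (const_series c) = const_series c) \<and>
     (\<forall>f\<in>A. \<forall>g\<in>A. h (f + g) = h f + h g) \<and>
     (\<forall>f\<in>A. \<forall>g\<in>A. h (f * g) = h f * h g)"


section \<open>Frobenius orbits\<close>

text \<open>Throughout, the type \<open>'a\<close> is the field \<open>\<F>\<^sub>q\<close> and \<open>q = CARD('a)\<close>.\<close>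

definition frob :: "'a :: finite_field alg_closure \<Rightarrow> 'a alg_closure" where
  "frob z = z ^ CARD('a)"

definition frob_orbit :: "'a :: finite_field alg_closure \<Rightarrow> 'a alg_closure set" where
  "frob_orbit z = range (\<lambda>k. (frob ^^ k) z)"

definition Phi :: "'a :: finite_field alg_closure set set" where
  "Phi = frob_orbit ` (- {0})"

text \<open>The product of \<open>x - z\<close> over an orbit has its coefficients in \<open>\<F>\<^sub>q\<close>; it is the monic irreducible
  polynomial identified with the orbit. In particular \<open>x - 1\<close> is the orbit \<open>{1}\<close>.\<close>

definition orbit_poly :: "'a :: finite_field alg_closure set \<Rightarrow> 'a alg_closure poly" where
  "orbit_poly f = (\<Prod>z\<in>f. [:- z, 1:])"

definition deg_Phi :: "'a :: finite_field alg_closure set \<Rightarrow> nat" where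
  "deg_Phi f = degree (orbit_poly f)"


section \<open>Orbits of characters\<close>

text \<open>The multiplicative group of the subfield \<open>\<F>\<^bsub>q^n\<^esub>\<close> of the algebraic closure, for \<open>n \<ge> 1\<close>\<close>

definition M_grp :: "nat \<Rightarrow> 'a :: finite_field alg_closure set" where
  "M_grp n = {z. z \<noteq> 0 \<and> z ^ (CARD('a) ^ n) = z}"

text \<open>Characters are made total by the value 0 outside their group.\<close>

definition M_char :: "nat \<Rightarrow> ('a :: finite_field alg_closure \<Rightarrow> complex) set" where
  "M_char n = {\<chi>. (\<forall>z\<in>M_grp n. \<chi> z \<noteq> 0) \<and>
                  (\<forall>z\<in>M_grp n. \<forall>w\<in>M_grp n. \<chi> (z * w) = \<chi> z * \<chi> w) \<and>
                  (\<forall>z. z \<notin> M_grp n \<longrightarrow> \<chi> z = 0)}"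

text \<open>The norm \<open>M_grp n \<rightarrow> M_grp m\<close> and the embedding \<open>M_char m \<rightarrow> M_char n\<close>, for \<open>m\<close> dividing \<open>n\<close>\<close>

definition M_norm :: "nat \<Rightarrow> nat \<Rightarrow> 'a :: finite_field alg_closure \<Rightarrow> 'a alg_closure" where
  "M_norm n m z = (\<Prod>i<n div m. z ^ (CARD('a) ^ (m * i)))"

definition M_char_embed ::
  "nat \<Rightarrow> nat \<Rightarrow> ('a :: finite_field alg_closure \<Rightarrow> complex) \<Rightarrow> 'a alg_closure \<Rightarrow> complex" where
  "M_char_embed n m \<chi> z = (if z \<in> M_grp n then \<chi> (M_norm n m z) else 0)"

text \<open>The union of the groups \<open>M_char n\<close> along these embeddings is their direct limit: an element is an
  equivalence class of pairs \<open>(n, \<chi>)\<close> with \<open>\<chi> \<in> M_char n\<close>.\<close>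

type_synonym 'a level_char = "nat \<times> ('a alg_closure \<Rightarrow> complex)"
type_synonym 'a lim_char = "'a level_char set"

definition level_chars :: "'a :: finite_field level_char set" where
  "level_chars = (SIGMA n:{1..}. M_char n)"

definition char_rel :: "'a :: finite_field level_char rel" where
  "char_rel = {((m, \<chi>), (n, \<psi>)). (m, \<chi>) \<in> level_chars \<and> (n, \<psi>) \<in> level_chars \<and>
     (\<exists>N\<ge>1. m dvd N \<and> n dvd N \<and> M_char_embed N m \<chi> = M_char_embed N n \<psi>)}"

definition lim_chars :: "'a :: finite_field lim_char set" where
  "lim_chars = level_chars // char_rel"

text \<open>The map \<open>\<xi> \<mapsto> \<xi>\<^sup>q\<close>\<close>

definition frob_char :: "'a :: finite_field lim_char \<Rightarrow> 'a lim_char" where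
  "frob_char \<xi> = char_rel `` {(n, \<lambda>z. \<chi> z ^ CARD('a)) | n \<chi>. (n, \<chi>) \<in> \<xi>}"

definition Theta :: "'a :: finite_field lim_char set set" where
  "Theta = (\<lambda>\<xi>. range (\<lambda>k. (frob_char ^^ k) \<xi>)) ` lim_chars"

definition deg_Theta :: "'a :: finite_field lim_char set \<Rightarrow> nat" where
  "deg_Theta \<phi> = card \<phi>"

text \<open>The representative of \<open>\<xi>\<close> in \<open>M_char n\<close>. It is unique since the embeddings are injective, and
  exists if \<open>\<xi>\<close> lies in the image of \<open>M_char n\<close>, in particular if the degree of the orbit of \<open>\<xi>\<close>
  divides \<open>n\<close>.\<close>

definition char_at :: "'a :: finite_field lim_char \<Rightarrow> nat \<Rightarrow> 'a alg_closure \<Rightarrow> complex" where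
  "char_at \<xi> n = (THE \<chi>. (n, \<chi>) \<in> \<xi>)"


section \<open>The maps\<close>

type_synonym 'a X_series = "('a alg_closure set \<times> nat) mv_series"
type_synonym 'a Y_series = "('a lim_char set \<times> nat) mv_series"

definition is_T :: "('a :: finite_field Y_series \<Rightarrow> 'a X_series) \<Rightarrow> bool" where
  "is_T T \<longleftrightarrow> calg_hom (sym_tensor Theta) (sym_tensor Phi) T \<and>
     (\<forall>\<phi>\<in>Theta. \<forall>\<xi>\<in>\<phi>. \<forall>k\<ge>1. let n = k * deg_Theta \<phi> in
        T (sym_p k (alphabet \<phi>)) =
          const_series ((-1) ^ (n - 1)) *
          (\<Sum>z\<in>M_grp n. const_series (char_at \<xi> n z) *
             sym_p (n div deg_Phi (frob_orbit z)) (alphabet (frob_orbit z))))"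

text \<open>The alphabet \<open>Y = {y\<^sub>1, y\<^sub>2, \<dots>}\<close> is the type of natural numbers.\<close>

definition is_rho :: "('a :: finite_field Y_series \<Rightarrow> nat mv_series) \<Rightarrow> bool" where
  "is_rho \<rho> \<longleftrightarrow> calg_hom (sym_tensor Theta) (sym_fun UNIV) \<rho> \<and>
     (\<forall>\<phi>\<in>Theta. \<forall>a. \<rho> (sym_h a (alphabet \<phi>)) = power_vars (deg_Theta \<phi>) (sym_h a UNIV))"

definition is_Pi :: "('a :: finite_field X_series \<Rightarrow> 'a X_series) \<Rightarrow> bool" where
  "is_Pi \<pi> \<longleftrightarrow> calg_hom (sym_tensor Phi) (sym_fun (alphabet {1})) \<pi> \<and>
     (\<forall>u\<in>sym_fun (alphabet {1}). \<pi> u = u) \<and>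
     (\<forall>f\<in>Phi - {{1}}. \<forall>r\<ge>1. \<pi> (sym_p r (alphabet f)) = 0)"

definition is_omega :: "(nat mv_series \<Rightarrow> nat mv_series) \<Rightarrow> bool" where
  "is_omega \<omega> \<longleftrightarrow> calg_hom (sym_fun UNIV) (sym_fun UNIV) \<omega> \<and>
     (\<forall>r. \<omega> (sym_e r UNIV) = sym_h r UNIV)"

definition change_vars :: "nat mv_series \<Rightarrow> 'a :: finite_field X_series" where
  "change_vars = rename_vars (\<lambda>i. ({1}, i))"

end

theory Submission
  imports Defs "HOL-Combinatorics.Orbits"
begin

text \<open>
  Over \<open>\<complex>\<close> the power sums generate the symmetric functions, so it suffices to compare the two composites
  on \<open>p\<^sub>k(Y\<^sup>\<phi>)\<close>. Put \<open>n = k d(\<phi>)\<close>. In \<open>T(p\<^sub>k(Y\<^sup>\<phi>))\<close> the projection kills every summand except that of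
  \<open>z = 1\<close>, where \<open>\<xi>(1) = 1\<close>, leaving \<open>(-1)\<^bsup>n-1\<^esup> p\<^sub>n(X\<^bsub>x-1\<^esub>)\<close>. On the other side Newton's identities turn the
  prescriptions on \<open>h\<^sub>a\<close> and \<open>e\<^sub>r\<close> into \<open>\<rho>(p\<^sub>k(Y\<^sup>\<phi>)) = p\<^sub>n(Y)\<close> and \<open>\<omega>(p\<^sub>n) = (-1)\<^bsup>n-1\<^esup> p\<^sub>n\<close>.

  That \<open>\<xi>\<close> has a representative on \<open>M\<^sub>n\<close> is Hilbert's theorem 90: \<open>\<xi>\<close> is fixed by the \<open>n\<close>-th power of Frobenius,
  hence trivial on the kernel of the norm to \<open>M\<^sub>n\<close>. Surjectivity of the norm and the description of its kernel
  both come from extracting roots in the algebraic closure.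
\<close>

section \<open>Coefficients and substitutions\<close>

lemma mcoeff_simps [simp]:
  "mcoeff 0 m = 0"
  "mcoeff 1 m = (if m = {#} then 1 else 0)"
  "mcoeff (f + g) m = mcoeff f m + mcoeff g m"
  "mcoeff (const_series c) m = (if m = {#} then c else 0)"
  by (transfer; simp)+

lemma mcoeff_sum: "mcoeff (sum f A) m = (\<Sum>x\<in>A. mcoeff (f x) m)"
  by (induction A rule: infinite_finite_induct) auto

lemma mcoeff_times:
  "mcoeff (f * g) m = (\<Sum>(a, b) \<in> {(a, b). a + b = m}. mcoeff f a * mcoeff g b)"
  by transfer auto

lemma mcoeff_times_nonzeroE:
  assumes "mcoeff (f * g) m \<noteq> 0"
  obtains a b where "a + b = m" "mcoeff f a \<noteq> 0" "mcoeff g b \<noteq> 0"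
proof -
  from assms have "\<exists>x \<in> {(a, b). a + b = m}. mcoeff f (fst x) * mcoeff g (snd x) \<noteq> 0"
    unfolding mcoeff_times case_prod_unfold by (meson sum.neutral)
  then show ?thesis using that by auto
qed

lemma mcoeff_const_times [simp]: "mcoeff (const_series c * f) m = c * mcoeff f (m :: 'v multiset)"
proof -
  have "(\<Sum>(a, b) \<in> {(a, b). a + b = m}. mcoeff (const_series c) a * mcoeff f b)
      = (\<Sum>(a, b) \<in> {({#} :: 'v multiset, m)}. mcoeff (const_series c) a * mcoeff f b)"
    by (rule sum.mono_neutral_right) (use finite_mset_splits in \<open>auto split: if_splits\<close>)
  then show ?thesis by (simp add: mcoeff_times)
qed

lemma const_series_mult: "const_series (c * d) = const_series c * const_series d"
  and const_series_0: "const_series 0 = 0"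
  and const_series_1: "const_series 1 = 1"
  by (auto intro!: mv_series_eqI)

lemma mcoeff_sym_h: "mcoeff (sym_h r Z) m = (if size m = r \<and> set_mset m \<subseteq> Z then 1 else 0)"
  by transfer auto

lemma mcoeff_sym_e:
  "mcoeff (sym_e r Z) m = (if size m = r \<and> set_mset m \<subseteq> Z \<and> (\<forall>v. count m v \<le> 1) then 1 else 0)"
  by transfer auto

lemma mcoeff_sym_p:
  "mcoeff (sym_p r Z) m = (if \<exists>z\<in>Z. m = replicate_mset r z then 1 else 0)"
  by transfer auto

lemma sym_h_0: "sym_h 0 Z = 1"
  by (auto intro!: mv_series_eqI simp: mcoeff_sym_h)

text \<open>A monomial of the power sum is z^k, and for k \<ge> 1 it determines z. The splittings of
  m that contribute therefore correspond to the variables z with z^k dividing m. All later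
  coefficient computations with power sums go through this formula.\<close>

lemma mcoeff_sym_p_times:
  assumes "k \<ge> 1"
  shows "mcoeff (sym_p k Z * f) m =
    (\<Sum>z | z \<in> Z \<and> k \<le> count m z. mcoeff f (m - replicate_mset k z))"
proof -
  let ?A = "{z \<in> Z. k \<le> count m z}"
  let ?g = "\<lambda>z. (replicate_mset k z, m - replicate_mset k z)"
  have inj: "inj_on ?g ?A"
  proof (rule inj_onI)
    fix x y assume "?g x = ?g y"
    then have "replicate_mset k x = replicate_mset k y" by simp
    then show "x = y" using assms by (metis in_replicate_mset not_one_le_zero neq0_conv)
  qed
  have "(\<Sum>x \<in> {(a, b). a + b = m}. mcoeff (sym_p k Z) (fst x) * mcoeff f (snd x))
      = (\<Sum>x \<in> ?g ` ?A. mcoeff (sym_p k Z) (fst x) * mcoeff f (snd x))"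
  proof (rule sum.mono_neutral_right)
    show "finite {(a, b). a + b = m}" by (rule finite_mset_splits)
    show "?g ` ?A \<subseteq> {(a, b). a + b = m}"
      by (auto simp flip: count_le_replicate_mset_subset_eq)
    show "\<forall>x\<in>{(a, b). a + b = m} - ?g ` ?A. mcoeff (sym_p k Z) (fst x) * mcoeff f (snd x) = 0"
      by (auto simp: mcoeff_sym_p image_iff)
  qed
  also have "\<dots> = (\<Sum>z\<in>?A. mcoeff (sym_p k Z) (replicate_mset k z) * mcoeff f (m - replicate_mset k z))"
    by (subst sum.reindex[OF inj]) simp
  also have "\<dots> = (\<Sum>z\<in>?A. mcoeff f (m - replicate_mset k z))"
    by (rule sum.cong) (auto simp: mcoeff_sym_p)
  finally show ?thesis by (simp add: mcoeff_times case_prod_unfold)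
qed

section \<open>Substitution of monomials as an algebra homomorphism\<close>

lemma mcoeff_subst_monom:
  assumes "inj \<theta>"
  shows "mcoeff (subst_monom \<theta> f) (\<theta> m) = mcoeff f m"
proof -
  have "{m'. \<theta> m' = \<theta> m} = {m}" using assms by (auto dest: injD)
  then show ?thesis by (simp add: subst_monom.rep_eq)
qed

lemma mcoeff_subst_monom_notin:
  "m \<notin> range \<theta> \<Longrightarrow> mcoeff (subst_monom \<theta> f) m = 0"
  by (auto simp: subst_monom.rep_eq intro!: sum.neutral)

lemma subst_monom_eqI:
  assumes "inj \<theta>" "\<And>m. mcoeff g (\<theta> m) = mcoeff f m" "\<And>m. m \<notin> range \<theta> \<Longrightarrow> mcoeff g m = 0"
  shows "subst_monom \<theta> f = g"
  by (rule mv_series_eqI) (metis assms mcoeff_subst_monom mcoeff_subst_monom_notin rangeE)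

lemma subst_monom_add:
  "inj \<theta> \<Longrightarrow> subst_monom \<theta> (f + g) = subst_monom \<theta> f + subst_monom \<theta> g"
  by (rule subst_monom_eqI) (auto simp: mcoeff_subst_monom mcoeff_subst_monom_notin)

text \<open>A splitting of \<theta>(m) contributes only if both parts lie in the range of \<theta>.
  By additivity and injectivity it then comes from exactly one splitting of m.\<close>

lemma subst_monom_mult:
  assumes inj: "inj \<theta>" and add: "\<And>a b. \<theta> (a + b) = \<theta> a + \<theta> b"
  shows "subst_monom \<theta> (f * g) = subst_monom \<theta> f * subst_monom \<theta> g"
proof (rule subst_monom_eqI[OF inj])
  fix m
  let ?h = "\<lambda>x. mcoeff (subst_monom \<theta> f) (fst x) * mcoeff (subst_monom \<theta> g) (snd x)"
  let ?t = "map_prod \<theta> \<theta>"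
  have "(\<Sum>x \<in> {(a, b). a + b = \<theta> m}. ?h x) = (\<Sum>x \<in> ?t ` {(a, b). a + b = m}. ?h x)"
  proof (rule sum.mono_neutral_right[OF finite_mset_splits])
    show "?t ` {(a, b). a + b = m} \<subseteq> {(a, b). a + b = \<theta> m}" by (auto simp: add)
    show "\<forall>x\<in>{(a, b). a + b = \<theta> m} - ?t ` {(a, b). a + b = m}. ?h x = 0"
    proof clarsimp
      fix a b assume *: "a + b = \<theta> m" "(a, b) \<notin> ?t ` {(a, b). a + b = m}"
        "mcoeff (subst_monom \<theta> g) b \<noteq> 0"
      show "mcoeff (subst_monom \<theta> f) a = 0"
      proof (rule ccontr)
        assume "mcoeff (subst_monom \<theta> f) a \<noteq> 0"
        then obtain a' b' where "a = \<theta> a'" "b = \<theta> b'"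
          using *(3) mcoeff_subst_monom_notin by (metis rangeE)
        moreover from this have "a' + b' = m" using *(1) inj by (metis add injD)
        ultimately show False using *(2) by force
      qed
    qed
  qed
  also have "\<dots> = (\<Sum>(a, b) \<in> {(a, b). a + b = m}. mcoeff f a * mcoeff g b)"
    by (subst sum.reindex)
       (auto intro!: sum.cong inj_onI simp: mcoeff_subst_monom[OF inj] dest: injD[OF inj])
  finally show "mcoeff (subst_monom \<theta> f * subst_monom \<theta> g) (\<theta> m) = mcoeff (f * g) m"
    by (simp add: mcoeff_times case_prod_unfold)
next
  fix m assume m: "m \<notin> range \<theta>"
  show "mcoeff (subst_monom \<theta> f * subst_monom \<theta> g) m = 0"
  proof (rule ccontr)
    assume "mcoeff (subst_monom \<theta> f * subst_monom \<theta> g) m \<noteq> 0"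
    then obtain a b where "a + b = m" "a \<in> range \<theta>" "b \<in> range \<theta>"
      by (metis mcoeff_times_nonzeroE mcoeff_subst_monom_notin)
    with m show False by (auto simp flip: add)
  qed
qed

lemma subst_monom_const:
  assumes inj: "inj \<theta>" and 0: "\<theta> {#} = {#}"
  shows "subst_monom \<theta> (const_series c) = const_series c"
proof -
  have "\<theta> m = {#} \<longleftrightarrow> m = {#}" for m
    using 0 inj by (metis injD)
  then show ?thesis using 0 by (intro subst_monom_eqI[OF inj]) auto
qed

lemma inj_image_mset: "inj g \<Longrightarrow> inj (image_mset g)"
  by (meson injD injI multiset.inj_map)

lemma inj_repeat_mset: "b \<ge> 1 \<Longrightarrow> inj (repeat_mset b)"
  by (auto intro!: injI simp: multiset_eq_iff)

lemma power_vars_mult: "b \<ge> 1 \<Longrightarrow> power_vars b (f * g) = power_vars b f * power_vars b g"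
  unfolding power_vars_def by (intro subst_monom_mult inj_repeat_mset) auto

lemma power_vars_add: "b \<ge> 1 \<Longrightarrow> power_vars b (f + g) = power_vars b f + power_vars b g"
  unfolding power_vars_def by (intro subst_monom_add inj_repeat_mset) auto

lemma power_vars_const: "b \<ge> 1 \<Longrightarrow> power_vars b (const_series c) = const_series c"
  unfolding power_vars_def by (intro subst_monom_const inj_repeat_mset) auto

text \<open>The plethysm p_k[p_b] = p_(kb): the b-th power of z^k is z^(kb).\<close>

lemma power_vars_sym_p:
  assumes "b \<ge> 1"
  shows "power_vars b (sym_p k UNIV) = sym_p (k * b) UNIV"
  unfolding power_vars_def
proof (rule subst_monom_eqI[OF inj_repeat_mset[OF assms]])
  have *: "repeat_mset b (replicate_mset k z) = replicate_mset (k * b) z" for z :: 'a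
    by (auto simp: multiset_eq_iff)
  show "mcoeff (sym_p (k * b) UNIV) (repeat_mset b m) = mcoeff (sym_p k UNIV) m" for m :: "'a multiset"
    unfolding mcoeff_sym_p *[symmetric] inj_eq[OF inj_repeat_mset[OF assms]] ..
  show "mcoeff (sym_p (k * b) UNIV) m = 0" if "m \<notin> range (repeat_mset b)" for m :: "'a multiset"
    using that unfolding mcoeff_sym_p *[symmetric] by auto
qed

lemma rename_vars_mult: "inj g \<Longrightarrow> rename_vars g (u * v) = rename_vars g u * rename_vars g v"
  unfolding rename_vars_def by (intro subst_monom_mult inj_image_mset) auto

lemma rename_vars_add: "inj g \<Longrightarrow> rename_vars g (u + v) = rename_vars g u + rename_vars g v"
  unfolding rename_vars_def by (intro subst_monom_add inj_image_mset) auto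

lemma rename_vars_const: "inj g \<Longrightarrow> rename_vars g (const_series c) = const_series c"
  unfolding rename_vars_def by (intro subst_monom_const inj_image_mset) auto

lemma rename_vars_sym_p:
  assumes "inj g"
  shows "rename_vars g (sym_p k UNIV) = sym_p k (range g)"
  unfolding rename_vars_def
proof (rule subst_monom_eqI[OF inj_image_mset[OF assms]])
  have *: "image_mset g (replicate_mset k z) = replicate_mset k (g z)" for z
    by (simp add: image_replicate_mset)
  show "mcoeff (sym_p k (range g)) (image_mset g m) = mcoeff (sym_p k UNIV) m" for m
    unfolding mcoeff_sym_p bex_UNIV bex_simps *[symmetric] inj_eq[OF inj_image_mset[OF assms]] by simp
  show "mcoeff (sym_p k (range g)) m = 0" if "m \<notin> range (image_mset g)" for m
    using that unfolding mcoeff_sym_p bex_simps *[symmetric] by (metis rangeI)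
qed


section \<open>Generation by power sums\<close>

text \<open>Invariance becomes being a fixed point of \<open>rename_vars \<sigma>\<close>, which
  respects sums and products. Closure of the symmetric functions under ring operations then needs no
  work on coefficients.\<close>

lemma sym_fun_iff_rename:
  "f \<in> sym_fun Z \<longleftrightarrow> (\<forall>m. mcoeff f m \<noteq> 0 \<longrightarrow> set_mset m \<subseteq> Z) \<and>
     (\<exists>D. \<forall>m. mcoeff f m \<noteq> 0 \<longrightarrow> size m \<le> D) \<and> (\<forall>\<sigma>. \<sigma> permutes Z \<longrightarrow> rename_vars \<sigma> f = f)"
proof -
  have "rename_vars \<sigma> f = f \<longleftrightarrow> (\<forall>m. mcoeff f (image_mset \<sigma> m) = mcoeff f m)" if "\<sigma> permutes Z" for \<sigma>
  proof -
    have inj: "inj (image_mset \<sigma>)"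
      using permutes_inj[OF that] by (rule inj_image_mset)
    have "range (image_mset \<sigma>) = UNIV"
    proof (rule surjI)
      show "image_mset \<sigma> (image_mset (inv_into UNIV \<sigma>) m) = m" for m
        by (simp add: image_mset.compositionality permutes_inverses[OF that] comp_def)
    qed
    then show ?thesis
      unfolding rename_vars_def
      by (metis UNIV_I inj mcoeff_subst_monom subst_monom_eqI)
  qed
  then show ?thesis unfolding sym_fun_def by blast
qed

lemma sym_fun_const: "const_series c \<in> sym_fun Z"
  unfolding sym_fun_iff_rename by (auto simp: rename_vars_const permutes_inj)

lemma sym_fun_add:
  assumes "f \<in> sym_fun Z" "g \<in> sym_fun Z" shows "f + g \<in> sym_fun Z"
proof -
  obtain D E where "\<And>m. mcoeff f m \<noteq> 0 \<Longrightarrow> size m \<le> D" "\<And>m. mcoeff g m \<noteq> 0 \<Longrightarrow> size m \<le> E"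
    using assms unfolding sym_fun_def by blast
  then have "size m \<le> max D E" if "mcoeff (f + g) m \<noteq> 0" for m
    using that by (metis add.right_neutral le_max_iff_disj mcoeff_simps(3))
  moreover have "set_mset m \<subseteq> Z" if "mcoeff (f + g) m \<noteq> 0" for m
    using that assms unfolding sym_fun_def by (metis (mono_tags, lifting) add.right_neutral mcoeff_simps(3) mem_Collect_eq)
  ultimately show ?thesis
    using assms unfolding sym_fun_iff_rename by (auto simp: rename_vars_add permutes_inj)
qed

lemma sym_fun_mult:
  assumes "f \<in> sym_fun Z" "g \<in> sym_fun Z" shows "f * g \<in> sym_fun Z"
proof -
  obtain D E where "\<And>m. mcoeff f m \<noteq> 0 \<Longrightarrow> size m \<le> D" "\<And>m. mcoeff g m \<noteq> 0 \<Longrightarrow> size m \<le> E"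
    using assms unfolding sym_fun_def by blast
  then have "size m \<le> D + E" if "mcoeff (f * g) m \<noteq> 0" for m
    using mcoeff_times_nonzeroE[OF that] by (metis add_mono size_union)
  moreover have "set_mset m \<subseteq> Z" if "mcoeff (f * g) m \<noteq> 0" for m
  proof (rule mcoeff_times_nonzeroE[OF that])
    fix a b assume "a + b = m" "mcoeff f a \<noteq> 0" "mcoeff g b \<noteq> 0"
    moreover from this have "set_mset a \<subseteq> Z" "set_mset b \<subseteq> Z"
      using assms by (simp_all add: sym_fun_def)
    ultimately show ?thesis by auto
  qed
  ultimately show ?thesis
    using assms unfolding sym_fun_iff_rename by (auto simp: rename_vars_mult permutes_inj)
qed

lemma sym_fun_sum: "(\<And>x. x \<in> I \<Longrightarrow> f x \<in> sym_fun Z) \<Longrightarrow> sum f I \<in> sym_fun Z"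
  by (induction I rule: infinite_finite_induct)
     (auto intro: sym_fun_add simp: sym_fun_const simp flip: const_series_0)

lemma sym_p_in_sym_fun: "sym_p k Z \<in> sym_fun Z"
proof -
  have "(\<exists>z\<in>Z. image_mset \<sigma> m = replicate_mset k z) \<longleftrightarrow> (\<exists>z\<in>Z. m = replicate_mset k z)"
    if \<sigma>: "\<sigma> permutes Z" for \<sigma> and m :: "'a multiset"
  proof
    assume "\<exists>z\<in>Z. image_mset \<sigma> m = replicate_mset k z"
    then obtain z where "z \<in> Z" "image_mset \<sigma> m = replicate_mset k z" ..
    moreover have "image_mset (inv_into UNIV \<sigma>) (image_mset \<sigma> m) = m"
      by (simp add: image_mset.compositionality permutes_inverses[OF \<sigma>] comp_def)
    ultimately have "m = replicate_mset k (inv_into UNIV \<sigma> z)" by simp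
    moreover have "inv_into UNIV \<sigma> z \<in> Z" using \<open>z \<in> Z\<close> permutes_in_image[OF permutes_inv[OF \<sigma>]] by blast
    ultimately show "\<exists>z\<in>Z. m = replicate_mset k z" by blast
  qed (auto simp: permutes_in_image[OF \<sigma>])
  then show ?thesis
    by (auto simp: sym_fun_def mcoeff_sym_p split: if_splits)
qed

lemma sym_h_in_sym_fun: "sym_h k Z \<in> sym_fun Z"
  unfolding sym_fun_def by (auto simp: mcoeff_sym_h permutes_in_image)

lemma count_image_mset_inj: "inj f \<Longrightarrow> count (image_mset f m) (f x) = count m x"
  by (induction m) (auto dest: injD)

lemma sym_e_in_sym_fun: "sym_e k Z \<in> sym_fun Z"
proof -
  have "(\<forall>v. count (image_mset \<sigma> m) v \<le> 1) \<longleftrightarrow> (\<forall>v. count m v \<le> 1)"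
    if "\<sigma> permutes Z" for \<sigma> and m :: "'a multiset"
    using permutes_bij[OF that] by (metis bij_iff count_image_mset_inj permutes_inj that)
  then show ?thesis
    unfolding sym_fun_def by (auto simp: mcoeff_sym_e permutes_in_image)
qed

section \<open>Exponent partitions of monomials and products of power sums\<close>

definition exponents :: "'v multiset \<Rightarrow> nat multiset" where
  "exponents m = image_mset (count m) (mset_set (set_mset m))"

lemma exponents_empty [simp]: "exponents {#} = {#}"
  by (simp add: exponents_def)

lemma size_exponents [simp]: "size (exponents m) = card (set_mset m)"
  by (simp add: exponents_def)

lemma exponents_add:
  assumes "k \<ge> 1" "z \<notin># m"
  shows "exponents (replicate_mset k z + m) = add_mset k (exponents m)"
proof -
  have "set_mset (replicate_mset k z + m) = insert z (set_mset m)"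
    using assms by auto
  moreover have "image_mset (count (replicate_mset k z + m)) (mset_set (set_mset m)) =
      image_mset (count m) (mset_set (set_mset m))"
    by (rule image_mset_cong) (use assms in auto)
  moreover have "count m z = 0" using assms(2) by (simp add: not_in_iff)
  ultimately show ?thesis
    using assms by (simp add: exponents_def)
qed

text \<open>The exponent partition determines the orbit of a monomial under permutations of the
  variables. On the union of the two supports, with exponent 0 where a variable is missing, both
  exponent functions have the same multiset of values, so a permutation of this union carries one to
  the other.\<close>

lemma exponents_eq_imp_permutes:
  assumes "exponents m = exponents m'" "set_mset m \<subseteq> Z" "set_mset m' \<subseteq> Z"
  obtains \<sigma> where "\<sigma> permutes Z" "image_mset \<sigma> m = m'"
proof -
  let ?A = "set_mset m \<union> set_mset m'"
  have *: "image_mset (count n) (mset_set ?A) =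
      exponents n + replicate_mset (card ?A - card (set_mset n)) 0"
    if "n = m \<or> n = m'" for n
  proof -
    let ?B = "?A - set_mset n"
    have "mset_set ?A = mset_set (set_mset n) + mset_set ?B"
      using that by (subst mset_set_Union[symmetric]) (auto intro!: arg_cong[of _ _ mset_set])
    moreover have "image_mset (count n) (mset_set ?B) = image_mset (\<lambda>_. 0) (mset_set ?B)"
      by (rule image_mset_cong) (auto simp: not_in_iff)
    moreover have "card ?B = card ?A - card (set_mset n)"
      using that by (intro card_Diff_subset) auto
    ultimately show ?thesis by (simp add: exponents_def image_mset_const_eq)
  qed
  \<comment> \<open>Equal numbers of distinct variables mean that both sides are padded with the
    same number of zeros.\<close>
  have "card (set_mset m) = card (set_mset m')"
    using assms(1) by (metis size_exponents)
  then have "image_mset (count m) (mset_set ?A) = image_mset (count m') (mset_set ?A)"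
    using assms(1) by (simp add: *)
  then obtain p where p: "p permutes ?A" "\<forall>x\<in>?A. count m x = count m' (p x)"
    by (rule image_mset_eq_implies_permutes[rotated]) auto
  have "count m x = count m' (p x)" for x
    using p by (cases "x \<in> ?A") (auto simp: not_in_iff permutes_not_in)
  then have "image_mset p m = m'"
    using permutes_bij[OF p(1)]
    by (intro multiset_eqI) (metis bij_iff count_image_mset_inj p(1) permutes_inj)
  moreover have "p permutes Z" using p(1) assms by (meson le_sup_iff permutes_subset)
  ultimately show ?thesis using that by blast
qed

definition sym_p_prod :: "'v set \<Rightarrow> nat multiset \<Rightarrow> 'v mv_series" where
  "sym_p_prod Z \<mu> = (\<Prod>k\<in>#\<mu>. sym_p k Z)"

lemma sym_p_prod_simps [simp]:
  "sym_p_prod Z {#} = 1"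
  "sym_p_prod Z (add_mset k \<mu>) = sym_p k Z * sym_p_prod Z \<mu>"
  by (simp_all add: sym_p_prod_def)

lemma sym_p_prod_in_sym_fun: "sym_p_prod Z \<mu> \<in> sym_fun Z"
  by (induction \<mu>) (auto intro: sym_fun_mult sym_p_in_sym_fun simp: sym_fun_const simp flip: const_series_1)

text \<open>Each factor p_k multiplies the monomial by some z^k and so adds at most one variable.
  The maximal number of variables is reached only if all factors choose different variables, and
  then the exponents are exactly the parts of \<mu>.\<close>

lemma sym_p_prod_support:
  assumes "mcoeff (sym_p_prod Z \<mu>) m \<noteq> 0" "\<forall>k\<in>#\<mu>. k \<ge> 1"
  shows "card (set_mset m) \<le> size \<mu> \<and> (card (set_mset m) = size \<mu> \<longrightarrow> exponents m = \<mu>)"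
  using assms
proof (induction \<mu> arbitrary: m)
  case (add k \<mu>)
  have k: "k \<ge> 1" using add.prems by simp
  obtain a m' where am: "a + m' = m" "mcoeff (sym_p k Z) a \<noteq> 0" "mcoeff (sym_p_prod Z \<mu>) m' \<noteq> 0"
    using add.prems(1) by (auto elim: mcoeff_times_nonzeroE)
  then obtain z where m: "m = replicate_mset k z + m'"
    by (auto simp: mcoeff_sym_p split: if_splits)
  have IH: "card (set_mset m') \<le> size \<mu>" "card (set_mset m') = size \<mu> \<Longrightarrow> exponents m' = \<mu>"
    using add.IH[OF am(3)] add.prems(2) by auto
  have "set_mset m = insert z (set_mset m')" using k by (auto simp: m)
  then show ?case
    using IH k by (cases "z \<in># m'") (auto simp: insert_absorb exponents_add m)
qed (auto split: if_splits)

text \<open>This excludes cancellation when a leading coefficient is shown to be nonzero. Real parts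
  are taken because the coefficients are complex.\<close>

lemma mcoeff_sym_p_prod_nonneg: "\<forall>k\<in>#\<mu>. k \<ge> 1 \<Longrightarrow> 0 \<le> Re (mcoeff (sym_p_prod Z \<mu>) m)"
  by (induction \<mu> arbitrary: m) (auto simp: mcoeff_sym_p_times intro!: sum_nonneg)

lemma exponents_ge_1: "k \<in># exponents m \<Longrightarrow> k \<ge> 1"
  by (auto simp: exponents_def Suc_le_eq)

text \<open>Strip off one variable z with its full exponent k. In the expansion of p_k times the
  remaining product, the summand of z is positive by induction and the others are
  nonnegative.\<close>

lemma mcoeff_sym_p_prod_exponents:
  "set_mset m \<subseteq> Z \<Longrightarrow> 0 < Re (mcoeff (sym_p_prod Z (exponents m)) m)"
proof (induction "size m" arbitrary: m rule: less_induct)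
  case less
  show ?case
  proof (cases "m = {#}")
    case False
    then obtain z where z: "z \<in># m" by auto
    define k where "k = count m z"
    have k: "k \<ge> 1" using z by (simp add: k_def Suc_le_eq)
    define m' where "m' = m - replicate_mset k z"
    have m: "m = replicate_mset k z + m'"
      unfolding m'_def k_def by (simp flip: count_le_replicate_mset_subset_eq)
    have z': "z \<notin># m'" by (simp add: m'_def k_def not_in_iff)
    have pos: "0 < Re (mcoeff (sym_p_prod Z (exponents m')) m')"
      by (rule less.hyps) (use k less.prems in \<open>auto simp: m\<close>)
    have "0 < (\<Sum>x | x \<in> Z \<and> k \<le> count m x. Re (mcoeff (sym_p_prod Z (exponents m')) (m - replicate_mset k x)))"
    proof (rule sum_pos2)
      have "{x \<in> Z. k \<le> count m x} \<subseteq> set_mset m"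
        using k by (auto simp: Suc_le_eq simp flip: count_greater_zero_iff)
      then show "finite {x \<in> Z. k \<le> count m x}" by (rule finite_subset) simp
      show "z \<in> {x \<in> Z. k \<le> count m x}" using z less.prems by (auto simp: k_def)
      show "0 < Re (mcoeff (sym_p_prod Z (exponents m')) (m - replicate_mset k z))"
        using pos by (simp add: m'_def)
      show "0 \<le> Re (mcoeff (sym_p_prod Z (exponents m')) (m - replicate_mset k x))" for x
        by (rule mcoeff_sym_p_prod_nonneg) (use exponents_ge_1 in blast)
    qed
    moreover have "exponents m = add_mset k (exponents m')"
      unfolding m by (rule exponents_add[OF k z'])
    ultimately show ?thesis using k by (simp add: mcoeff_sym_p_times)
  qed auto
qed

text \<open>A symmetric function may have infinitely many monomials, but bounded degree leaves only
  finitely many exponent partitions: they have at most D parts, each at most D.\<close>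

lemma finite_exponents_bounded: "finite (exponents ` {m. size m \<le> D})"
proof (rule finite_subset)
  show "exponents ` {m :: 'a multiset. size m \<le> D} \<subseteq> {\<mu>. \<mu> \<subseteq># repeat_mset D (mset_set {..D})}"
  proof clarify
    fix m :: "'a multiset" assume m: "size m \<le> D"
    show "exponents m \<subseteq># repeat_mset D (mset_set {..D})"
    proof (rule mset_subset_eqI)
      fix k
      have "count (exponents m) k \<le> size (exponents m)" by (rule count_le_size)
      also have "\<dots> \<le> D" 
        using m size_mset_mono[OF mset_set_set_mset_msubset[of m]] by simp
      finally have 1: "count (exponents m) k \<le> D" .
      have "k \<le> D" if k: "k \<in># exponents m"
      proof -
        obtain z where "k = count m z" using k by (auto simp: exponents_def)
        then show ?thesis using count_le_size[of m z] m by simp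
      qed
      then show "count (exponents m) k \<le> count (repeat_mset D (mset_set {..D})) k"
        using 1 by (cases "k \<in># exponents m") (auto simp: not_in_iff)
    qed
  qed
qed (rule finite_sub_mset)

text \<open>\<open>sym_p_prod Z \<mu>\<close> is a positive multiple of the monomial symmetric function of \<open>\<mu>\<close> up to monomials
  in fewer variables; hence the induction on the number of distinct variables in a monomial.\<close>

lemma sym_fun_power_sum_induct:
  assumes f: "f \<in> sym_fun Z"
    and const: "\<And>c. const_series c \<in> A"
    and p: "\<And>k. k \<ge> 1 \<Longrightarrow> sym_p k Z \<in> A"
    and add: "\<And>f g. f \<in> A \<Longrightarrow> g \<in> A \<Longrightarrow> f + g \<in> A"
    and mult: "\<And>f g. f \<in> A \<Longrightarrow> g \<in> A \<Longrightarrow> f * g \<in> A"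
  shows "f \<in> A"
proof -
  have sum: "sum g I \<in> A" if "\<And>x. x \<in> I \<Longrightarrow> g x \<in> A" for g and I :: "nat multiset set"
    using that const[of 0]
    by (induction I rule: infinite_finite_induct) (auto intro: add simp: const_series_0)
  have prod: "sym_p_prod Z \<mu> \<in> A" if "\<forall>k\<in>#\<mu>. k \<ge> 1" for \<mu>
    using that const[of 1] by (induction \<mu>) (auto intro!: mult p simp: const_series_1)
  have "f \<in> A" if "f \<in> sym_fun Z" "\<And>m. mcoeff f m \<noteq> 0 \<Longrightarrow> card (set_mset m) \<le> l" for l f
    using that
  proof (induction l arbitrary: f)
    case 0
    have "f = const_series (mcoeff f {#})"
      by (rule mv_series_eqI) (use 0(2) in auto)
    then show ?case using const by metis
  next
    case (Suc l)
    obtain D where D: "\<And>m. mcoeff f m \<noteq> 0 \<Longrightarrow> size m \<le> D"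
      using Suc.prems(1) by (auto simp: sym_fun_def)
    have Z: "set_mset m \<subseteq> Z" if "mcoeff f m \<noteq> 0" for m
      using Suc.prems(1) that by (auto simp: sym_fun_def)
    let ?M = "{m. mcoeff f m \<noteq> 0 \<and> card (set_mset m) = Suc l}"
    \<comment> \<open>The partitions of the leading monomials, those in the largest allowed number
      \<open>Suc l\<close> of variables.\<close>
    define L where "L = exponents ` ?M"
    have "finite L"
      unfolding L_def by (rule finite_subset[OF _ finite_exponents_bounded[of D]]) (auto intro: D)
    have "\<forall>\<mu>\<in>L. \<exists>m. m \<in> ?M \<and> exponents m = \<mu>" by (auto simp: L_def)
    then obtain r where r: "\<And>\<mu>. \<mu> \<in> L \<Longrightarrow> r \<mu> \<in> ?M \<and> exponents (r \<mu>) = \<mu>" by metis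
    have L: "size \<mu> = Suc l" "\<forall>k\<in>#\<mu>. k \<ge> 1" if "\<mu> \<in> L" for \<mu>
      using that by (auto simp: L_def dest: exponents_ge_1)
    \<comment> \<open>Chosen so that \<open>S\<close> matches \<open>f\<close> at the representative
      \<open>r \<mu>\<close>; the denominator is nonzero by
      \<open>mcoeff_sym_p_prod_exponents\<close>.\<close>
    define c where "c \<mu> = mcoeff f (r \<mu>) / mcoeff (sym_p_prod Z \<mu>) (r \<mu>)" for \<mu>
    define S where "S = (\<Sum>\<mu>\<in>L. const_series (c \<mu>) * sym_p_prod Z \<mu>)"
    define g where "g = f + const_series (-1) * S"
    have "S \<in> A" unfolding S_def by (intro sum mult const prod L)
    have "S \<in> sym_fun Z" unfolding S_def by (intro sym_fun_sum sym_fun_mult sym_fun_const sym_p_prod_in_sym_fun)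
    then have g_sym: "g \<in> sym_fun Z"
      unfolding g_def by (intro sym_fun_add sym_fun_mult sym_fun_const Suc.prems)
    \<comment> \<open>At a monomial in more than l variables only the product indexed by its own
      exponent partition can contribute to \<open>S\<close>. Symmetry moves the monomial to the
      representative, where \<open>S\<close> and \<open>f\<close> agree, so the leading part cancels
      in \<open>g\<close>.\<close>
    have "card (set_mset m) \<le> l" if g_m: "mcoeff g m \<noteq> 0" for m
    proof (rule ccontr)
      assume m: "\<not> card (set_mset m) \<le> l"
      have m_Z: "set_mset m \<subseteq> Z" using g_sym g_m by (auto simp: sym_fun_def)
      have supp: "card (set_mset m) = Suc l \<and> exponents m = \<mu>"
        if "\<mu> \<in> L" "mcoeff (sym_p_prod Z \<mu>) m \<noteq> 0" for \<mu>
        using sym_p_prod_support[OF that(2) L(2)[OF that(1)]] L(1)[OF that(1)] m by auto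
      have S_m: "mcoeff S m = (\<Sum>\<mu>\<in>L. c \<mu> * mcoeff (sym_p_prod Z \<mu>) m)"
        by (simp add: S_def mcoeff_sum)
      have "mcoeff S m = mcoeff f m"
      proof (cases "exponents m \<in> L")
        case True
        let ?\<mu> = "exponents m"
        have "mcoeff S m = (\<Sum>\<mu>\<in>{?\<mu>}. c \<mu> * mcoeff (sym_p_prod Z \<mu>) m)"
          unfolding S_m by (rule sum.mono_neutral_right[OF \<open>finite L\<close>]) (use True supp in auto)
        also have "\<dots> = c ?\<mu> * mcoeff (sym_p_prod Z ?\<mu>) m" by simp
        finally have S: "mcoeff S m = c ?\<mu> * mcoeff (sym_p_prod Z ?\<mu>) m" .
        obtain \<sigma> where \<sigma>: "\<sigma> permutes Z" "image_mset \<sigma> (r ?\<mu>) = m"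
          by (rule exponents_eq_imp_permutes[of "r ?\<mu>" m Z]) (use r[OF True] Z m_Z in auto)
        have "mcoeff h m = mcoeff h (r ?\<mu>)" if "h \<in> sym_fun Z" for h
        proof -
          have "mcoeff h (image_mset \<sigma> (r ?\<mu>)) = mcoeff h (r ?\<mu>)"
            using that \<sigma>(1) by (simp add: sym_fun_def)
          then show ?thesis using \<sigma>(2) by simp
        qed
        then have "mcoeff f m = mcoeff f (r ?\<mu>)"
          "mcoeff (sym_p_prod Z ?\<mu>) m = mcoeff (sym_p_prod Z ?\<mu>) (r ?\<mu>)"
          using Suc.prems(1) sym_p_prod_in_sym_fun by blast+
        moreover have "mcoeff (sym_p_prod Z ?\<mu>) m \<noteq> 0"
          using mcoeff_sym_p_prod_exponents[OF m_Z] by auto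
        ultimately show ?thesis using S by (simp add: c_def)
      next
        case False
        then have "mcoeff S m = 0" unfolding S_m using supp by (intro sum.neutral) auto
        moreover have "mcoeff f m = 0"
          using False Suc.prems(2)[of m] m unfolding L_def by force
        ultimately show ?thesis by simp
      qed
      with g_m show False by (simp add: g_def)
    qed
    then have "g \<in> A" by (rule Suc.IH[OF g_sym])
    moreover have "f = g + S" by (rule mv_series_eqI) (simp add: g_def)
    ultimately show ?case using \<open>S \<in> A\<close> add by simp
  qed
  moreover obtain D where "\<And>m. mcoeff f m \<noteq> 0 \<Longrightarrow> size m \<le> D"
    using f by (auto simp: sym_fun_def)
  moreover have "card (set_mset m) \<le> size m" for m :: "'a multiset"
    using size_mset_mono[OF mset_set_set_mset_msubset[of m]] by simp
  ultimately show ?thesis using f by (meson order_trans)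
qed

section \<open>Newton's identities\<close>

text \<open>Fix a monomial of degree k in Z. A variable z of it yields one term for each i from 1 to
  its exponent, and the exponents add up to k.\<close>

lemma newton_h:
  "const_series (of_nat k) * sym_h k Z = (\<Sum>i=1..k. sym_p i Z * sym_h (k - i) Z)"
proof (rule mv_series_eqI)
  fix m
  have "mcoeff (sym_p i Z * sym_h (k - i) Z) m =
      (\<Sum>z\<in>set_mset m. if i \<le> count m z \<and> size m = k \<and> set_mset m \<subseteq> Z then 1 else 0)"
    if "i \<in> {1..k}" for i
  proof -
    have "mcoeff (sym_h (k - i) Z) (m - replicate_mset i z) =
        (if size m = k \<and> set_mset m \<subseteq> Z then 1 else 0)" if z: "z \<in> Z" "i \<le> count m z" for z
    proof -
      obtain m' where m': "m = replicate_mset i z + m'"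
        using z(2) by (metis count_le_replicate_mset_subset_eq subset_mset.add_diff_inverse)
      show ?thesis using \<open>i \<in> {1..k}\<close> z(1) by (auto simp: m' mcoeff_sym_h)
    qed
    then have "mcoeff (sym_p i Z * sym_h (k - i) Z) m =
      (\<Sum>z | z \<in> Z \<and> i \<le> count m z. if size m = k \<and> set_mset m \<subseteq> Z then 1 else 0)"
      using that by (subst mcoeff_sym_p_times) auto
    also have "\<dots> = (\<Sum>z\<in>set_mset m. if i \<le> count m z \<and> size m = k \<and> set_mset m \<subseteq> Z then 1 else 0)"
    proof (rule sum.mono_neutral_cong_left)
      show "{z \<in> Z. i \<le> count m z} \<subseteq> set_mset m"
        using that by (auto simp: Suc_le_eq simp flip: count_greater_zero_iff)
    qed auto
    finally show ?thesis .
  qed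
  then have "mcoeff (\<Sum>i=1..k. sym_p i Z * sym_h (k - i) Z) m =
     (\<Sum>i=1..k. \<Sum>z\<in>set_mset m. if i \<le> count m z \<and> size m = k \<and> set_mset m \<subseteq> Z then 1 else 0)"
    unfolding mcoeff_sum by (rule sum.cong[OF refl])
  also have "\<dots> = (\<Sum>z\<in>set_mset m. \<Sum>i=1..k. if i \<le> count m z \<and> size m = k \<and> set_mset m \<subseteq> Z then 1 else 0)"
    by (rule sum.swap)
  also have "\<dots> = (if size m = k \<and> set_mset m \<subseteq> Z then of_nat k else 0)"
  proof (cases "size m = k \<and> set_mset m \<subseteq> Z")
    case True
    have "(\<Sum>i=1..k. if i \<le> count m z then 1 else 0 :: complex) = of_nat (count m z)" for z
    proof -
      have "count m z \<le> k" using True count_le_size by metis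
      then have "{1..k} \<inter> {i. i \<le> count m z} = {1..count m z}" by auto
      then show ?thesis by (simp add: sum.If_cases)
    qed
    then show ?thesis using True by (simp add: size_multiset_overloaded_eq flip: of_nat_sum)
  next
    case False
    then have 0: "(if i \<le> count m z \<and> size m = k \<and> set_mset m \<subseteq> Z then 1 else 0 :: complex) = 0" for i z
      by auto
    show ?thesis unfolding 0 using False by auto
  qed
  finally show "mcoeff (const_series (of_nat k) * sym_h k Z) m =
    mcoeff (\<Sum>i=1..k. sym_p i Z * sym_h (k - i) Z) m"
    by (simp add: mcoeff_sym_h)
qed

text \<open>Removing z^i leaves a squarefree monomial only if the other variables occur at most once
  and i is the exponent of z or one less. If z occurs at least twice, both choices exist and their
  signs cancel. If it occurs once, only i = 1 remains, so a squarefree monomial collects 1 from each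
  of its k variables.\<close>

lemma newton_e:
  "const_series (of_nat k) * sym_e k Z =
     (\<Sum>i=1..k. const_series ((-1) ^ (i - 1)) * sym_p i Z * sym_e (k - i) Z)"
proof (rule mv_series_eqI)
  fix m
  let ?sf = "\<lambda>m. \<forall>v. count m v \<le> 1"
  let ?c = "\<lambda>i z. if i \<le> count m z \<and> size m = k \<and> set_mset m \<subseteq> Z \<and> ?sf (m - replicate_mset i z)
    then (-1) ^ (i - 1) else (0 :: complex)"
  have "mcoeff (const_series ((-1) ^ (i - 1)) * sym_p i Z * sym_e (k - i) Z) m = (\<Sum>z\<in>set_mset m. ?c i z)"
    if "i \<in> {1..k}" for i
  proof -
    have "mcoeff (sym_e (k - i) Z) (m - replicate_mset i z) =
        (if size m = k \<and> set_mset m \<subseteq> Z \<and> ?sf (m - replicate_mset i z) then 1 else 0)"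
      if z: "z \<in> Z" "i \<le> count m z" for z
    proof -
      obtain m' where m': "m = replicate_mset i z + m'"
        using z(2) by (metis count_le_replicate_mset_subset_eq subset_mset.add_diff_inverse)
      show ?thesis using \<open>i \<in> {1..k}\<close> z(1) by (auto simp: m' mcoeff_sym_e)
    qed
    then have "mcoeff (const_series ((-1) ^ (i - 1)) * sym_p i Z * sym_e (k - i) Z) m =
      (-1) ^ (i - 1) * (\<Sum>z | z \<in> Z \<and> i \<le> count m z.
         if size m = k \<and> set_mset m \<subseteq> Z \<and> ?sf (m - replicate_mset i z) then 1 else 0)"
      using that by (simp add: mult.assoc mcoeff_sym_p_times)
    also have "\<dots> = (\<Sum>z | z \<in> Z \<and> i \<le> count m z. ?c i z)"
      unfolding sum_distrib_left by (rule sum.cong) auto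
    also have "\<dots> = (\<Sum>z\<in>set_mset m. ?c i z)"
    proof (rule sum.mono_neutral_left)
      show "{z \<in> Z. i \<le> count m z} \<subseteq> set_mset m"
        using that by (auto simp: Suc_le_eq simp flip: count_greater_zero_iff)
    qed auto
    finally show ?thesis .
  qed
  then have "mcoeff (\<Sum>i=1..k. const_series ((-1) ^ (i - 1)) * sym_p i Z * sym_e (k - i) Z) m =
     (\<Sum>i=1..k. \<Sum>z\<in>set_mset m. ?c i z)"
    unfolding mcoeff_sum by (rule sum.cong[OF refl])
  also have "\<dots> = (\<Sum>z\<in>set_mset m. \<Sum>i=1..k. ?c i z)"
    by (rule sum.swap)
  also have "\<dots> = (\<Sum>z\<in>set_mset m. if size m = k \<and> set_mset m \<subseteq> Z \<and> ?sf m then 1 else 0)"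
  proof (rule sum.cong[OF refl])
    fix z assume z: "z \<in># m"
    define c where "c = count m z"
    have "c \<ge> 1" using z by (simp add: c_def Suc_le_eq)
    show "(\<Sum>i=1..k. ?c i z) = (if size m = k \<and> set_mset m \<subseteq> Z \<and> ?sf m then 1 else 0)"
    proof (cases "size m = k \<and> set_mset m \<subseteq> Z \<and> (\<forall>v. v \<noteq> z \<longrightarrow> count m v \<le> 1)")
      case True
      then have "c \<le> k" by (metis c_def count_le_size)
      have sf: "?sf (m - replicate_mset i z) \<longleftrightarrow> c - i \<le> 1" for i
        using True by (auto simp: c_def)
      have c: "?c i z = (if i = c \<or> Suc i = c then (-1) ^ (i - 1) else 0)" for i
        unfolding sf using True by (auto simp: c_def)
      \<comment> \<open>The index 0 is outside the range of summation; hence a single term is left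
        exactly when c = 1.\<close>
      have "(\<Sum>i=1..k. ?c i z) = (\<Sum>i\<in>{c - 1, c} - {0}. (-1) ^ (i - 1))"
        unfolding c by (rule sum.mono_neutral_cong_right) (use \<open>c \<ge> 1\<close> \<open>c \<le> k\<close> in auto)
      also have "\<dots> = (if c \<le> 1 then 1 else 0)"
      proof (cases "c = 1")
        case False
        then obtain d where "c = Suc (Suc d)"
          using \<open>c \<ge> 1\<close> by (metis One_nat_def Suc_le_D not0_implies_Suc)
        then show ?thesis by simp
      qed simp
      also have "c \<le> 1 \<longleftrightarrow> ?sf m" using True by (auto simp: c_def)
      finally show ?thesis using True by simp
    next
      case False
      then have "?c i z = 0" for i by auto
      with False show ?thesis by (auto simp del: One_nat_def)
    qed
  qed
  also have "\<dots> = (if size m = k \<and> set_mset m \<subseteq> Z \<and> ?sf m then of_nat k else 0)"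
  proof (cases "size m = k \<and> set_mset m \<subseteq> Z \<and> ?sf m")
    case True
    then have "count m v = 1" if "v \<in># m" for v
      using that by (simp add: antisym Suc_le_eq)
    then have "size m = card (set_mset m)"
      by (simp add: size_multiset_overloaded_eq)
    with True show ?thesis by simp
  qed auto
  finally show "mcoeff (const_series (of_nat k) * sym_e k Z) m =
    mcoeff (\<Sum>i=1..k. const_series ((-1) ^ (i - 1)) * sym_p i Z * sym_e (k - i) Z) m"
    by (simp add: mcoeff_sym_e)
qed

section \<open>Power sums under algebra homomorphisms\<close>

lemma calg_homD:
  assumes "calg_hom A B h"
  shows "f \<in> A \<Longrightarrow> h f \<in> B" "h (const_series c) = const_series c"
    "f \<in> A \<Longrightarrow> g \<in> A \<Longrightarrow> h (f + g) = h f + h g"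
    "f \<in> A \<Longrightarrow> g \<in> A \<Longrightarrow> h (f * g) = h f * h g"
  using assms by (auto simp: calg_hom_def)

text \<open>Membership of the partial sums is carried through the induction, since h is known to be
  additive only on A.\<close>

lemma calg_hom_sum:
  assumes h: "calg_hom A B h" and A: "\<And>c. const_series c \<in> A" "\<And>f g. f \<in> A \<Longrightarrow> g \<in> A \<Longrightarrow> f + g \<in> A"
    and f: "\<And>x. x \<in> I \<Longrightarrow> f x \<in> A"
  shows "sum f I \<in> A \<and> h (sum f I) = (\<Sum>x\<in>I. h (f x))"
  using f
proof (induction I rule: infinite_finite_induct)
  case (insert x I)
  then show ?case by (auto simp: calg_homD[OF h] intro!: A(2))
qed (use A(1)[of 0] calg_homD(2)[OF h, of 0] in \<open>auto simp: const_series_0\<close>)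

text \<open>The recursion is triangular, and \<open>h 0 = 1\<close> puts 1 on the diagonal. So it
  can be solved for p k without division.\<close>

lemma newton_recursion_unique:
  fixes k :: nat
  assumes p: "\<And>k. k \<ge> 1 \<Longrightarrow> c k = (\<Sum>i=1..k. p i * h (k - i))"
    and p': "\<And>k. k \<ge> 1 \<Longrightarrow> c k = (\<Sum>i=1..k. p' i * h (k - i))"
    and "h 0 = (1 :: 'b :: comm_ring_1)" "k \<ge> 1"
  shows "p k = p' k"
  using \<open>k \<ge> 1\<close>
proof (induction k rule: less_induct)
  case (less k)
  have "(\<Sum>i=1..k. q i * h (k - i)) = q k + (\<Sum>i=1..<k. q i * h (k - i))" for q
  proof -
    have "{1..k} = insert k {1..<k}" using less.prems by auto
    then show ?thesis using \<open>h 0 = 1\<close> by simp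
  qed
  moreover have "(\<Sum>i=1..<k. p i * h (k - i)) = (\<Sum>i=1..<k. p' i * h (k - i))"
    using less.IH by (intro sum.cong) auto
  ultimately show ?case using p[OF less.prems] p'[OF less.prems] by simp
qed

lemma power_vars_sum:
  "b \<ge> 1 \<Longrightarrow> power_vars b (sum f I) = (\<Sum>x\<in>I. power_vars b (f x))"
  using power_vars_const[of b 0]
  by (induction I rule: infinite_finite_induct) (auto simp: power_vars_add const_series_0)

text \<open>Both \<rho> and \<open>power_vars b\<close> turn Newton's identity into a recursion with
  the same images of the complete functions, so they agree on power sums. The value is
  p_k[p_b].\<close>

lemma calg_hom_sym_p_of_sym_h:
  assumes \<rho>: "calg_hom A B \<rho>" and A: "\<And>c. const_series c \<in> A"
    "\<And>f g. f \<in> A \<Longrightarrow> g \<in> A \<Longrightarrow> f + g \<in> A" "\<And>f g. f \<in> A \<Longrightarrow> g \<in> A \<Longrightarrow> f * g \<in> A"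
    and Z: "sym_fun Z \<subseteq> A" and b: "b \<ge> 1"
    and h: "\<And>a. \<rho> (sym_h a Z) = power_vars b (sym_h a UNIV)" and k: "k \<ge> 1"
  shows "\<rho> (sym_p k Z) = sym_p (k * b) UNIV"
proof -
  have in_A: "sym_p i Z \<in> A" "sym_h i Z \<in> A" for i
    using Z sym_p_in_sym_fun sym_h_in_sym_fun by blast+
  have "\<rho> (sym_p k Z) = power_vars b (sym_p k UNIV)"
  proof (rule newton_recursion_unique[OF _ _ _ k])
    show "power_vars b (sym_h 0 UNIV) = 1"
      using power_vars_const[OF b, of 1] by (simp add: sym_h_0 const_series_1)
    fix k :: nat assume "k \<ge> 1"
    have "\<rho> (const_series (of_nat k) * sym_h k Z) = (\<Sum>i=1..k. \<rho> (sym_p i Z * sym_h (k - i) Z))"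
      unfolding newton_h by (intro conjunct2[OF calg_hom_sum[OF \<rho> A(1,2)]] A(3) in_A)
    then show "const_series (of_nat k) * power_vars b (sym_h k UNIV) =
        (\<Sum>i=1..k. \<rho> (sym_p i Z) * power_vars b (sym_h (k - i) UNIV))"
      by (simp add: calg_homD[OF \<rho>] A in_A h)
    have "power_vars b (const_series (of_nat k) * sym_h k (UNIV :: 'b set)) =
        (\<Sum>i=1..k. power_vars b (sym_p i UNIV * sym_h (k - i) UNIV))"
      unfolding newton_h using power_vars_sum[OF b] .
    then show "const_series (of_nat k) * power_vars b (sym_h k (UNIV :: 'b set)) =
        (\<Sum>i=1..k. power_vars b (sym_p i UNIV) * power_vars b (sym_h (k - i) UNIV))"
      by (simp add: power_vars_mult[OF b] power_vars_const[OF b])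
  qed
  then show ?thesis by (simp add: power_vars_sym_p[OF b])
qed

text \<open>Applying \<omega> to Newton's identity for the elementary functions gives the identity
  for the complete ones, with the signed images of the power sums in place of the power
  sums.\<close>

lemma omega_sym_p:
  assumes \<omega>: "calg_hom (sym_fun Z) B \<omega>" and e: "\<And>r. \<omega> (sym_e r Z) = sym_h r Z" and k: "k \<ge> 1"
  shows "\<omega> (sym_p k Z) = const_series ((-1) ^ (k - 1)) * sym_p k Z"
proof -
  have "const_series ((-1) ^ (k - 1)) * \<omega> (sym_p k Z) = sym_p k Z"
  proof (rule newton_recursion_unique[OF _ _ _ k])
    show "sym_h 0 Z = 1" by (rule sym_h_0)
    fix k :: nat
    show "const_series (of_nat k) * sym_h k Z = (\<Sum>i=1..k. sym_p i Z * sym_h (k - i) Z)"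
      by (rule newton_h)
    have "\<omega> (const_series (of_nat k) * sym_e k Z) =
        (\<Sum>i=1..k. \<omega> (const_series ((-1) ^ (i - 1)) * sym_p i Z * sym_e (k - i) Z))"
      unfolding newton_e
      by (intro conjunct2[OF calg_hom_sum[OF \<omega> sym_fun_const sym_fun_add]]
            sym_fun_mult sym_fun_const sym_p_in_sym_fun sym_e_in_sym_fun)
    then show "const_series (of_nat k) * sym_h k Z =
        (\<Sum>i=1..k. const_series ((-1) ^ (i - 1)) * \<omega> (sym_p i Z) * sym_h (k - i) Z)"
      by (simp add: calg_homD[OF \<omega>] e sym_fun_mult sym_fun_const sym_p_in_sym_fun sym_e_in_sym_fun)
  qed
  then have "const_series ((-1) ^ (k - 1)) * sym_p k Z =
      const_series ((-1) ^ (k - 1) * (-1) ^ (k - 1)) * \<omega> (sym_p k Z)"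
    by (simp only: const_series_mult mult.assoc)
  then show ?thesis
    by (simp add: const_series_1 flip: power_mult_distrib)
qed

section \<open>Norms and characters\<close>

text \<open>The orbit has as many points as the least period of x, and that period holds at every
  point of the orbit because iterates commute. It serves both for characters and for field
  elements.\<close>

lemma funpow_periodic_orbit:
  assumes per: "(f ^^ n) x = x" "n \<ge> 1"
  shows "finite (range (\<lambda>k. (f ^^ k) x))" "card (range (\<lambda>k. (f ^^ k) x)) \<ge> 1"
    "card (range (\<lambda>k. (f ^^ k) x)) \<le> n"
    "y \<in> range (\<lambda>k. (f ^^ k) x) \<Longrightarrow> (f ^^ card (range (\<lambda>k. (f ^^ k) x))) y = y"
proof -
  let ?O = "range (\<lambda>k. (f ^^ k) x)"
  have "0 < n" using per(2) by linarith
  then have orb: "x \<in> orbit f x" unfolding orbit_altdef using per(1) by (intro CollectI exI[of _ n]) simp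
  define d where "d = funpow_dist1 f x x"
  have d: "(f ^^ d) x = x" "d \<ge> 1" using funpow_dist1_prop[OF orb] by (simp_all add: d_def)
  have O: "?O = orbit f x" unfolding orbit_altdef_self_in[OF orb] by auto
  have "orbit f x = (\<lambda>n. (f ^^ n) x) ` {0..<d}"
    unfolding d_def by (rule orbit_conv_funpow_dist1[OF orb])
  then have card: "card ?O = d"
    using inj_on_funpow_dist1[OF orb] unfolding O d_def by (simp add: card_image)
  show "finite ?O" unfolding O by (rule finite_orbit[OF orb])
  show "card ?O \<ge> 1" using card d by simp
  have "d \<le> n"
    using funpow_dist1_least[OF \<open>0 < n\<close>, of f x x] per(1) unfolding d_def by linarith
  then show "card ?O \<le> n" using card by simp
  show "(f ^^ card ?O) y = y" if y_in: "y \<in> ?O"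
  proof -
    obtain k where y: "y = (f ^^ k) x" using y_in by (rule rangeE)
    have "(f ^^ d) y = (f ^^ k) ((f ^^ d) x)"
      unfolding y by (metis add.commute comp_apply funpow_add)
    then show ?thesis by (simp add: card d y)
  qed
qed

section \<open>The groups M_n and the norm maps between them\<close>

lemma card_finite_field_ge_2: "CARD('a :: finite_field) \<ge> 2"
proof -
  have "2 = card {0, 1 :: 'a}" by (simp add: card_insert_if)
  also have "\<dots> \<le> CARD('a)" by (rule card_mono[OF finite subset_UNIV])
  finally show ?thesis .
qed

lemma card_power_gt_1:
  assumes "n \<ge> 1"
  shows "CARD('a :: finite_field) ^ n > 1"
proof (rule one_less_power)
  show "1 < CARD('a)" using card_finite_field_ge_2[where 'a = 'a] by linarith
  show "0 < n" using assms by linarith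
qed

text \<open>M_n is the group of roots of unity of order dividing q^n - 1. As this exponent is
  positive, the equation already excludes 0.\<close>

lemma M_grp_iff:
  fixes z :: "'a :: finite_field alg_closure"
  assumes "n \<ge> 1"
  shows "z \<in> M_grp n \<longleftrightarrow> z ^ (CARD('a) ^ n - 1) = 1"
proof -
  obtain N where N: "CARD('a) ^ n = Suc (Suc N)"
    using card_power_gt_1[OF assms, where 'a = 'a] less_iff_Suc_add by auto
  show ?thesis unfolding M_grp_def N by auto
qed

lemma finite_M_grp:
  assumes "n \<ge> 1"
  shows "finite (M_grp n :: 'a :: finite_field alg_closure set)"
proof -
  let ?N = "CARD('a) ^ n - 1"
  let ?p = "monom 1 ?N - 1 :: 'a alg_closure poly"
  have "coeff ?p ?N = 1"
    using card_power_gt_1[OF assms, where 'a = 'a] by (auto simp: coeff_1)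
  then have "?p \<noteq> 0" by (metis coeff_0 zero_neq_one)
  then have "finite {z. poly ?p z = 0}" by (rule poly_roots_finite)
  then show ?thesis by (rule finite_subset[rotated]) (auto simp: M_grp_iff[OF assms] poly_monom)
qed

lemma M_grp_mult: "z \<in> M_grp n \<Longrightarrow> w \<in> M_grp n \<Longrightarrow> z * w \<in> M_grp n"
  by (simp add: M_grp_def power_mult_distrib)

lemma one_in_M_grp: "1 \<in> M_grp n"
  by (simp add: M_grp_def)

lemma M_grp_power: "z \<in> M_grp n \<Longrightarrow> z ^ j \<in> M_grp n"
  by (induction j) (simp_all add: one_in_M_grp M_grp_mult)

text \<open>The norm is a power map; for m dividing n, with m \<ge> 1 and q \<ge> 2, its exponent is
  (q^n - 1)/(q^m - 1).\<close>

definition norm_exp :: "nat \<Rightarrow> nat \<Rightarrow> nat \<Rightarrow> nat" where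
  "norm_exp q n m = (\<Sum>i<n div m. q ^ (m * i))"

lemma M_norm_eq_power:
  "M_norm n m (z :: 'a :: finite_field alg_closure) = z ^ norm_exp CARD('a) n m"
  by (simp add: M_norm_def norm_exp_def power_sum)

lemma norm_exp_mult:
  assumes "m dvd n"
  shows "norm_exp q n m * (q ^ m - 1) = q ^ n - 1"
proof (cases "q = 0 \<or> m = 0")
  case False
  \<comment> \<open>The geometric sum, with the 1 moved to the left so that the induction avoids
    truncated subtraction.\<close>
  have "(\<Sum>i<k. x ^ i) * (x - 1) + 1 = x ^ k" if "x \<ge> 1" for x k :: nat
  proof (induction k)
    case (Suc k)
    have "(\<Sum>i<Suc k. x ^ i) * (x - 1) + 1 = x ^ k + x ^ k * (x - 1)"
      using Suc by (simp add: distrib_right)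
    also have "\<dots> = x ^ k * (1 + (x - 1))" by (simp only: distrib_left mult_1_right)
    finally show ?case using that by simp
  qed simp
  then have "(\<Sum>i<n div m. (q ^ m) ^ i) * (q ^ m - 1) + 1 = (q ^ m) ^ (n div m)"
    using False by simp
  moreover have "(q ^ m) ^ (n div m) = q ^ n"
    unfolding power_mult[symmetric] dvd_mult_div_cancel[OF assms] ..
  moreover have "norm_exp q n m = (\<Sum>i<n div m. (q ^ m) ^ i)"
    by (simp add: norm_exp_def power_mult)
  ultimately show ?thesis by simp
qed (use assms in \<open>auto simp: power_0_left\<close>)

context
  fixes n m :: nat
  assumes n: "n \<ge> 1" and m: "m \<ge> 1" and dvd: "m dvd n"
begin

lemma norm_exp_pos: "norm_exp CARD('a :: finite_field) n m > 0"
proof (rule gr0I)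
  assume "norm_exp CARD('a) n m = 0"
  then have "CARD('a) ^ n - 1 = 0"
    unfolding norm_exp_mult[OF dvd, symmetric] by (simp only: mult_0)
  then show False using card_power_gt_1[OF n, where 'a = 'a] by linarith
qed

lemma M_norm_in_M_grp: "z \<in> M_grp n \<Longrightarrow> M_norm n m z \<in> M_grp m"
  unfolding M_grp_iff[OF n] M_grp_iff[OF m] M_norm_eq_power power_mult[symmetric] norm_exp_mult[OF dvd] .

text \<open>Take any root of w of order \<open>norm_exp\<close> in the algebraic closure. Its power
  with exponent q^n - 1 equals w^(q^m - 1) = 1, so it lies in M_n automatically.\<close>

lemma M_norm_surj:
  fixes w :: "'a :: finite_field alg_closure"
  assumes "w \<in> M_grp m"
  obtains z where "z \<in> M_grp n" "M_norm n m z = w"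
proof -
  obtain z where z: "z ^ norm_exp CARD('a) n m = w"
    using nth_root_exists[OF norm_exp_pos[where 'a = 'a], of w] ..
  have "z \<in> M_grp n \<longleftrightarrow> w \<in> M_grp m"
    unfolding M_grp_iff[OF n] M_grp_iff[OF m] z[symmetric] power_mult[symmetric] norm_exp_mult[OF dvd] ..
  then have "z \<in> M_grp n" using assms by blast
  then show ?thesis by (rule that) (simp only: M_norm_eq_power z)
qed

text \<open>Hilbert's theorem 90\<close>

lemma M_norm_kernel:
  fixes z :: "'a :: finite_field alg_closure"
  assumes "M_norm n m z = 1"
  obtains y where "y \<in> M_grp n" "z = y ^ (CARD('a) ^ m - 1)"
proof -
  \<comment> \<open>Any root y of z of order q^m - 1 works: y^(q^n - 1) is the norm of z, which is
    1, so y lies in M_n.\<close>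
  have "CARD('a) ^ m - 1 > 0" using card_power_gt_1[OF m, where 'a = 'a] by linarith
  from nth_root_exists[OF this, of z] obtain y where y: "y ^ (CARD('a) ^ m - 1) = z" ..
  have "y ^ (norm_exp CARD('a) n m * (CARD('a) ^ m - 1)) = 1"
    using assms by (subst mult.commute) (simp only: M_norm_eq_power power_mult y)
  then have "y \<in> M_grp n"
    unfolding M_grp_iff[OF n] norm_exp_mult[OF dvd] .
  then show ?thesis by (rule that) (rule y[symmetric])
qed

end

lemma M_norm_mult: "M_norm n m (z * w) = M_norm n m z * M_norm n m w"
  by (simp add: M_norm_eq_power power_mult_distrib)

lemma norm_exp_trans:
  assumes "q ^ m > 1" "m dvd n" "n dvd l"
  shows "norm_exp q l n * norm_exp q n m = norm_exp q l m"
proof -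
  have "norm_exp q l n * norm_exp q n m * (q ^ m - 1) = norm_exp q l m * (q ^ m - 1)"
    unfolding norm_exp_mult[OF dvd_trans[OF assms(2,3)]] mult.assoc norm_exp_mult[OF assms(2)]
      norm_exp_mult[OF assms(3)] ..
  then show ?thesis using assms(1) by (metis mult_cancel2 zero_less_diff less_numeral_extra(3))
qed

lemma M_norm_trans:
  assumes "m \<ge> 1" "m dvd n" "n dvd l"
  shows "M_norm n m (M_norm l n z) = M_norm l m z"
  unfolding M_norm_eq_power power_mult[symmetric]
    norm_exp_trans[OF card_power_gt_1[OF assms(1)] assms(2,3)] ..

section \<open>Characters, their embeddings and descent\<close>

lemma M_charD:
  assumes "\<chi> \<in> M_char n"
  shows "z \<in> M_grp n \<Longrightarrow> \<chi> z \<noteq> 0" "z \<in> M_grp n \<Longrightarrow> w \<in> M_grp n \<Longrightarrow> \<chi> (z * w) = \<chi> z * \<chi> w"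
    "z \<notin> M_grp n \<Longrightarrow> \<chi> z = 0"
  using assms by (auto simp: M_char_def)

lemma M_char_one:
  assumes "\<chi> \<in> M_char n"
  shows "\<chi> 1 = 1"
proof -
  have "\<chi> 1 * \<chi> 1 = \<chi> 1" "\<chi> 1 \<noteq> 0"
    using M_charD(1,2)[OF assms one_in_M_grp] one_in_M_grp[of n] by fastforce+
  then show ?thesis by simp
qed

lemma M_char_power: "\<chi> \<in> M_char n \<Longrightarrow> z \<in> M_grp n \<Longrightarrow> \<chi> (z ^ j) = \<chi> z ^ j"
  by (induction j) (simp_all add: M_char_one M_charD(2) M_grp_power)

lemma power_in_M_char: "\<chi> \<in> M_char n \<Longrightarrow> j \<ge> 1 \<Longrightarrow> (\<lambda>z. \<chi> z ^ j) \<in> M_char n"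
  by (auto simp: M_char_def power_mult_distrib zero_power)

text \<open>Characters of level n are fixed by the n-th power of Frobenius. This makes the orbits in
  \<Theta> finite.\<close>

lemma M_char_card_power:
  assumes "(\<chi> :: 'a :: finite_field alg_closure \<Rightarrow> complex) \<in> M_char n"
  shows "\<chi> z ^ (CARD('a) ^ n) = \<chi> z"
proof (cases "z \<in> M_grp n")
  case True
  then have "z ^ (CARD('a) ^ n) = z" by (simp add: M_grp_def)
  then show ?thesis using M_char_power[OF assms True, of "CARD('a) ^ n"] by simp
qed (simp add: M_charD(3)[OF assms] zero_power)

lemma M_char_embed_in_M_char:
  assumes "m \<ge> 1" "n \<ge> 1" "m dvd n" "\<chi> \<in> M_char m"
  shows "M_char_embed n m \<chi> \<in> M_char n"
  using assms M_norm_in_M_grp[of n m]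
  by (auto simp: M_char_def M_char_embed_def M_norm_mult M_grp_mult)

lemma M_char_embed_inj:
  assumes "m \<ge> 1" "n \<ge> 1" "m dvd n" "\<chi> \<in> M_char m" "\<psi> \<in> M_char m"
    "M_char_embed n m \<chi> = M_char_embed n m \<psi>"
  shows "\<chi> = \<psi>"
proof
  fix w show "\<chi> w = \<psi> w"
  proof (cases "w \<in> M_grp m")
    case True
    then obtain z where "z \<in> M_grp n" "M_norm n m z = w"
      using M_norm_surj assms(1-3) by blast
    then show ?thesis using fun_cong[OF assms(6), of z] by (simp add: M_char_embed_def)
  qed (use assms M_charD(3) in metis)
qed

lemma M_char_embed_trans:
  assumes "m \<ge> 1" "n \<ge> 1" "l \<ge> 1" "m dvd n" "n dvd l"
  shows "M_char_embed l n (M_char_embed n m \<chi>) = M_char_embed l m \<chi>"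
  using assms by (auto simp: M_char_embed_def fun_eq_iff M_norm_trans M_norm_in_M_grp)

lemma M_char_embed_power:
  "j \<ge> 1 \<Longrightarrow> M_char_embed n m (\<lambda>z. \<chi> z ^ j) = (\<lambda>z. M_char_embed n m \<chi> z ^ j)"
  by (auto simp: M_char_embed_def zero_power)

text \<open>A character fixed by the \<open>n\<close>-th power of Frobenius is trivial on \<open>(q\<^sup>n - 1)\<close>-th powers, hence
  on the kernel of the norm.\<close>

lemma M_char_descend:
  fixes \<chi> :: "'a :: finite_field alg_closure \<Rightarrow> complex"
  assumes n: "n \<ge> 1" and N: "N \<ge> 1" and dvd: "n dvd N" and \<chi>: "\<chi> \<in> M_char N"
    and fixed: "\<And>z. \<chi> z ^ (CARD('a) ^ n) = \<chi> z"
  obtains \<psi> where "\<psi> \<in> M_char n" "M_char_embed N n \<psi> = \<chi>"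
proof -
  have kernel: "\<chi> z = 1" if z: "M_norm N n z = 1" for z
  proof -
    obtain y where y: "y \<in> M_grp N" "z = y ^ (CARD('a) ^ n - 1)"
      using M_norm_kernel[OF N n dvd z] by blast
    have "\<chi> y * \<chi> y ^ (CARD('a) ^ n - 1) = \<chi> y"
      using fixed[of y] card_power_gt_1[OF n, where 'a = 'a] by (metis power_eq_if not_one_less_zero)
    then have "\<chi> y ^ (CARD('a) ^ n - 1) = 1"
      using M_charD(1)[OF \<chi> y(1)] by simp
    then show ?thesis using M_char_power[OF \<chi> y(1)] y(2) by simp
  qed
  have eq: "\<chi> z = \<chi> w" if z: "z \<in> M_grp N" and w: "w \<in> M_grp N" and "M_norm N n z = M_norm N n w" for z w
  proof -
    have 0: "w \<noteq> 0" using w by (simp add: M_grp_def)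
    then have "M_norm N n w \<noteq> 0" by (simp add: M_norm_eq_power)
    moreover have "M_norm N n (z / w) * M_norm N n w = M_norm N n z"
      using 0 by (simp flip: M_norm_mult)
    ultimately have "\<chi> (z / w) = 1" using that(3) by (intro kernel) simp
    moreover have "z / w \<in> M_grp N" using z w by (simp add: M_grp_def power_divide)
    ultimately show ?thesis using M_charD(2)[OF \<chi> _ w, of "z / w"] 0 by simp
  qed
  \<comment> \<open>A set-theoretic section of the norm; by \<open>eq\<close> the values of \<chi>
    do not depend on the chosen preimages, which makes \<psi> multiplicative.\<close>
  define s where "s w = (SOME z. z \<in> M_grp N \<and> M_norm N n z = w)" for w :: "'a alg_closure"
  have s: "s w \<in> M_grp N" "M_norm N n (s w) = w" if "w \<in> M_grp n" for w
    using someI_ex[of "\<lambda>z. z \<in> M_grp N \<and> M_norm N n z = w"] M_norm_surj[OF N n dvd that]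
    unfolding s_def by blast+
  define \<psi> where "\<psi> w = (if w \<in> M_grp n then \<chi> (s w) else 0)" for w
  have "\<psi> \<in> M_char n"
    unfolding M_char_def
  proof (intro CollectI conjI ballI allI impI)
    fix z w :: "'a alg_closure" assume zw: "z \<in> M_grp n" "w \<in> M_grp n"
    have "\<chi> (s (z * w)) = \<chi> (s z * s w)"
      by (rule eq) (use zw s in \<open>simp_all add: M_grp_mult M_norm_mult\<close>)
    then show "\<psi> (z * w) = \<psi> z * \<psi> w"
      using zw s M_charD(2)[OF \<chi>] by (simp add: \<psi>_def M_grp_mult)
  qed (use s M_charD(1)[OF \<chi>] in \<open>auto simp: \<psi>_def\<close>)
  moreover have "M_char_embed N n \<psi> = \<chi>"
  proof
    fix z show "M_char_embed N n \<psi> z = \<chi> z"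
    proof (cases "z \<in> M_grp N")
      case True
      then have "M_norm N n z \<in> M_grp n" by (rule M_norm_in_M_grp[OF N n dvd])
      moreover from this have "\<chi> (s (M_norm N n z)) = \<chi> z"
        by (intro eq s True)
      ultimately show ?thesis using True by (simp add: M_char_embed_def \<psi>_def)
    qed (simp add: M_char_embed_def M_charD(3)[OF \<chi>])
  qed
  ultimately show ?thesis using that by blast
qed

section \<open>The direct limit of the character groups and its Frobenius orbits\<close>

lemma level_chars_iff: "(n, \<chi>) \<in> level_chars \<longleftrightarrow> n \<ge> 1 \<and> \<chi> \<in> M_char n"
  by (auto simp: level_chars_def)

lemma equiv_char_rel: "equiv level_chars (char_rel :: 'a :: finite_field level_char rel)"
proof (rule equivI)
  show "char_rel \<subseteq> (level_chars \<times> level_chars :: 'a level_char rel)" by (auto simp: char_rel_def)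
  show "refl_on level_chars (char_rel :: 'a level_char rel)"
    by (auto simp: refl_on_def char_rel_def level_chars_iff)
  show "sym (char_rel :: 'a level_char rel)" by (auto simp: sym_def char_rel_def)
  show "trans (char_rel :: 'a level_char rel)"
  proof (rule transI, clarify)
    fix m n l and \<chi> \<psi> \<theta> :: "'a alg_closure \<Rightarrow> complex"
    assume 1: "((m, \<chi>), (n, \<psi>)) \<in> char_rel" and 2: "((n, \<psi>), (l, \<theta>)) \<in> char_rel"
    obtain N where N: "N \<ge> 1" "m dvd N" "n dvd N" "M_char_embed N m \<chi> = M_char_embed N n \<psi>"
      using 1 by (auto simp: char_rel_def)
    obtain K where K: "K \<ge> 1" "n dvd K" "l dvd K" "M_char_embed K n \<psi> = M_char_embed K l \<theta>"
      using 2 by (auto simp: char_rel_def)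
    have pos: "m \<ge> 1" "n \<ge> 1" "l \<ge> 1" "N * K \<ge> 1"
      using 1 2 N K by (auto simp: char_rel_def level_chars_iff)
    \<comment> \<open>Both given equalities are transported to the common level
      \<open>N * K\<close>.\<close>
    have "M_char_embed (N * K) m \<chi> = M_char_embed (N * K) N (M_char_embed N m \<chi>)"
      using M_char_embed_trans[of m N "N * K" \<chi>] pos N(1,2) by simp
    also have "\<dots> = M_char_embed (N * K) n \<psi>"
      unfolding N(4) using M_char_embed_trans[of n N "N * K" \<psi>] pos N(1,3) by simp
    also have "\<dots> = M_char_embed (N * K) K (M_char_embed K n \<psi>)"
      using M_char_embed_trans[of n K "N * K" \<psi>] pos K(1,2) by simp
    also have "\<dots> = M_char_embed (N * K) l \<theta>"
      unfolding K(4) using M_char_embed_trans[of l K "N * K" \<theta>] pos K(1,3) by simp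
    finally show "((m, \<chi>), (l, \<theta>)) \<in> char_rel"
      using 1 2 pos N K unfolding char_rel_def by (fastforce intro: exI[of _ "N * K"])
  qed
qed

abbreviation char_class :: "nat \<Rightarrow> ('a :: finite_field alg_closure \<Rightarrow> complex) \<Rightarrow> 'a lim_char" where
  "char_class n \<chi> \<equiv> char_rel `` {(n, \<chi>)}"

text \<open>Raising values to the q-th power commutes with the embeddings, so Frobenius can be
  computed on any representative.\<close>

lemma frob_char_class:
  fixes \<chi> :: "'a :: finite_field alg_closure \<Rightarrow> complex"
  assumes "(n, \<chi>) \<in> level_chars"
  shows "frob_char (char_class n \<chi>) = char_class n (\<lambda>z. \<chi> z ^ CARD('a))"
proof -
  let ?q = "CARD('a)"
  have q: "?q \<ge> 1" using card_finite_field_ge_2[where 'a = 'a] by simp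
  have *: "((n, \<lambda>z. \<chi> z ^ ?q), (m, \<lambda>z. \<psi> z ^ ?q)) \<in> char_rel" if rel: "((n, \<chi>), (m, \<psi>)) \<in> char_rel"
    for m \<psi>
  proof -
    obtain N where "N \<ge> 1" "n dvd N" "m dvd N" "M_char_embed N n \<chi> = M_char_embed N m \<psi>"
      using rel by (auto simp: char_rel_def)
    then show ?thesis
      using rel q unfolding char_rel_def by (auto simp: level_chars_iff power_in_M_char M_char_embed_power)
  qed
  have "((n, \<chi>), (n, \<chi>)) \<in> char_rel"
    using assms equiv_char_rel by (meson equiv_def refl_onD)
  show ?thesis
  proof (intro equalityI subsetI)
    fix x assume "x \<in> frob_char (char_class n \<chi>)"
    then obtain m \<psi> where "((n, \<chi>), (m, \<psi>)) \<in> char_rel" "((m, \<lambda>z. \<psi> z ^ ?q), x) \<in> char_rel"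
      by (auto simp: frob_char_def)
    then show "x \<in> char_class n (\<lambda>z. \<chi> z ^ ?q)"
      using * equiv_char_rel by (metis ImageI equiv_def singletonI transD)
  next
    fix x assume "x \<in> char_class n (\<lambda>z. \<chi> z ^ ?q)"
    then show "x \<in> frob_char (char_class n \<chi>)"
      using \<open>((n, \<chi>), (n, \<chi>)) \<in> char_rel\<close> by (auto simp: frob_char_def)
  qed
qed

lemma funpow_frob_char_class:
  fixes \<chi> :: "'a :: finite_field alg_closure \<Rightarrow> complex"
  assumes "(n, \<chi>) \<in> level_chars"
  shows "(frob_char ^^ k) (char_class n \<chi>) = char_class n (\<lambda>z. \<chi> z ^ (CARD('a) ^ k))"
    and "(n, \<lambda>z. \<chi> z ^ (CARD('a) ^ k)) \<in> level_chars"
proof -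
  show lev: "(n, \<lambda>z. \<chi> z ^ (CARD('a) ^ k)) \<in> level_chars" for k
    using assms by (simp add: level_chars_iff power_in_M_char Suc_le_eq)
  show "(frob_char ^^ k) (char_class n \<chi>) = char_class n (\<lambda>z. \<chi> z ^ (CARD('a) ^ k))"
  proof (induction k)
    case (Suc k)
    then show ?case by (simp add: frob_char_class[OF lev] mult.commute flip: power_mult)
  qed simp
qed

lemma Theta_orbit:
  assumes "\<phi> \<in> (Theta :: 'a :: finite_field lim_char set set)"
  shows "deg_Theta \<phi> \<ge> 1"
    and "\<xi> \<in> \<phi> \<Longrightarrow> (frob_char ^^ deg_Theta \<phi>) \<xi> = \<xi>"
    and "\<xi> \<in> \<phi> \<Longrightarrow> \<exists>n \<chi>. (n, \<chi>) \<in> level_chars \<and> \<xi> = char_class n \<chi>"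
proof -
  obtain n and \<chi> :: "'a alg_closure \<Rightarrow> complex"
    where \<chi>: "(n, \<chi>) \<in> level_chars" and \<phi>: "\<phi> = range (\<lambda>k. (frob_char ^^ k) (char_class n \<chi>))"
    using assms by (auto simp: Theta_def lim_chars_def elim!: quotientE)
  have n: "n \<ge> 1" using \<chi> by (simp add: level_chars_iff)
  have per: "(frob_char ^^ n) (char_class n \<chi>) = char_class n \<chi>"
    unfolding funpow_frob_char_class[OF \<chi>] using \<chi> by (simp add: M_char_card_power level_chars_iff)
  show "deg_Theta \<phi> \<ge> 1" unfolding deg_Theta_def \<phi> by (rule funpow_periodic_orbit[OF per n])
  show "(frob_char ^^ deg_Theta \<phi>) \<xi> = \<xi>" if "\<xi> \<in> \<phi>"
    using that unfolding deg_Theta_def \<phi> by (rule funpow_periodic_orbit[OF per n])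
  show "\<exists>n \<chi>. (n, \<chi>) \<in> level_chars \<and> \<xi> = char_class n \<chi>" if "\<xi> \<in> \<phi>"
    using that funpow_frob_char_class[OF \<chi>] unfolding \<phi> by blast
qed

text \<open>The definite description needs existence and uniqueness. As n is a multiple of the orbit
  length, \<xi> is fixed by the n-th power of Frobenius and descends to level n. Uniqueness is
  injectivity of the embeddings.\<close>

lemma char_at_in_M_char:
  assumes \<phi>: "\<phi> \<in> (Theta :: 'a :: finite_field lim_char set set)" and \<xi>: "\<xi> \<in> \<phi>"
    and k: "k \<ge> 1" and n: "n = k * deg_Theta \<phi>"
  shows "char_at \<xi> n \<in> M_char n"
proof -
  let ?q = "CARD('a)" and ?d = "deg_Theta \<phi>"
  have n1: "n \<ge> 1" using Theta_orbit(1)[OF \<phi>] k n by simp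
  obtain m \<chi> where \<chi>: "(m, \<chi>) \<in> level_chars" and \<xi>_eq: "\<xi> = char_class m \<chi>"
    using Theta_orbit(3)[OF \<phi> \<xi>] by blast
  have "(frob_char ^^ (j * ?d)) \<xi> = \<xi>" for j
    using Theta_orbit(2)[OF \<phi> \<xi>] by (induction j) (simp_all add: funpow_add)
  then have "char_class m (\<lambda>z. \<chi> z ^ (?q ^ n)) = char_class m \<chi>"
    using funpow_frob_char_class(1)[OF \<chi>, of n] by (simp add: n \<xi>_eq)
  then have "((m, \<lambda>z. \<chi> z ^ (?q ^ n)), (m, \<chi>)) \<in> char_rel"
    using equiv_char_rel \<chi> funpow_frob_char_class(2)[OF \<chi>] by (metis eq_equiv_class_iff)
  then obtain N where N: "N \<ge> 1" "m dvd N"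
      "M_char_embed N m (\<lambda>z. \<chi> z ^ (?q ^ n)) = M_char_embed N m \<chi>"
    by (auto simp: char_rel_def)
  have m: "m \<ge> 1" "\<chi> \<in> M_char m" using \<chi> by (auto simp: level_chars_iff)
  \<comment> \<open>Equality of classes becomes equality of functions, since the embedding into
    level N is injective.\<close>
  have fixed: "\<chi> z ^ (?q ^ n) = \<chi> z" for z
    using M_char_embed_inj[OF m(1) N(1,2) _ m(2) N(3)] m
    by (simp add: power_in_M_char Suc_le_eq fun_eq_iff)
  \<comment> \<open>A level above both m, where \<chi> lives, and n, to which it has to
    descend.\<close>
  let ?K = "m * n"
  have K: "?K \<ge> 1" "m dvd ?K" "n dvd ?K" using m n1 by auto
  obtain \<psi> where \<psi>: "\<psi> \<in> M_char n" "M_char_embed ?K n \<psi> = M_char_embed ?K m \<chi>"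
  proof (rule M_char_descend[OF n1 K(1,3)])
    show "M_char_embed ?K m \<chi> \<in> M_char ?K" by (rule M_char_embed_in_M_char[OF m(1) K(1,2) m(2)])
    show "M_char_embed ?K m \<chi> z ^ (?q ^ n) = M_char_embed ?K m \<chi> z" for z
      using fixed by (simp add: M_char_embed_def zero_power)
  qed
  have "(n, \<psi>) \<in> \<xi>"
    using \<psi> \<chi> n1 K unfolding \<xi>_eq by (auto simp: char_rel_def level_chars_iff intro!: exI[of _ ?K])
  moreover have "\<psi>' = \<psi>" if "(n, \<psi>') \<in> \<xi>" for \<psi>'
  proof -
    have "((n, \<psi>'), (n, \<psi>)) \<in> char_rel"
      using that \<open>(n, \<psi>) \<in> \<xi>\<close> equiv_char_rel unfolding \<xi>_eq
      by (metis Image_singleton_iff equiv_def symD transD)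
    then show ?thesis
      by (auto simp: char_rel_def level_chars_iff intro: M_char_embed_inj)
  qed
  ultimately have "char_at \<xi> n = \<psi>" unfolding char_at_def by (intro the_equality)
  with \<psi>(1) show ?thesis by simp
qed

section \<open>Frobenius orbits of field elements\<close>

lemma frob_orbit_one: "frob_orbit (1 :: 'a :: finite_field alg_closure) = {1}"
proof -
  have "(frob ^^ k) (1 :: 'a alg_closure) = 1" for k by (induction k) (simp_all add: frob_def)
  then show ?thesis by (auto simp: frob_orbit_def)
qed

lemma self_in_frob_orbit: "z \<in> frob_orbit z"
  unfolding frob_orbit_def by (rule range_eqI[of _ _ 0]) simp

lemma funpow_frob: "(frob ^^ k) (z :: 'a :: finite_field alg_closure) = z ^ (CARD('a) ^ k)"
  by (induction k) (simp_all add: frob_def mult.commute flip: power_mult)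

text \<open>The two bounds give \<open>n div deg_Phi (frob_orbit z) \<ge> 1\<close>, the range in
  which \<Pi> prescribes the image of a power sum. The degree is the orbit size because the orbit
  polynomial has one linear factor per point.\<close>

lemma deg_Phi_frob_orbit:
  fixes z :: "'a :: finite_field alg_closure"
  assumes "n \<ge> 1" "z \<in> M_grp n"
  shows "1 \<le> deg_Phi (frob_orbit z)" "deg_Phi (frob_orbit z) \<le> n"
proof -
  have per: "(frob ^^ n) z = z" using assms(2) by (simp add: funpow_frob M_grp_def)
  have "deg_Phi (frob_orbit z) = card (frob_orbit z)"
    by (simp add: deg_Phi_def orbit_poly_def degree_prod_eq_sum_degree)
  then show "1 \<le> deg_Phi (frob_orbit z)" "deg_Phi (frob_orbit z) \<le> n"
    using funpow_periodic_orbit(2,3)[OF per assms(1)] by (simp_all add: frob_orbit_def)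
qed

lemma frob_orbit_in_Phi: "z \<in> M_grp n \<Longrightarrow> frob_orbit z \<in> Phi"
  by (auto simp: Phi_def M_grp_def)

section \<open>The square\<close>

lemma Pi_T_sym_p:
  fixes T :: "'a :: finite_field Y_series \<Rightarrow> 'a X_series"
  assumes T: "is_T T" and \<pi>: "is_Pi \<pi>" and \<phi>: "\<phi> \<in> Theta" and k: "k \<ge> 1"
    and n: "n = k * deg_Theta \<phi>"
  shows "\<pi> (T (sym_p k (alphabet \<phi>))) = const_series ((-1) ^ (n - 1)) * sym_p n (alphabet {1})"
proof -
  have n1: "n \<ge> 1" using k Theta_orbit(1)[OF \<phi>] by (simp add: n)
  obtain \<xi> where \<xi>: "\<xi> \<in> \<phi>" using \<phi> by (auto simp: Theta_def)
  let ?p = "\<lambda>z :: 'a alg_closure. sym_p (n div deg_Phi (frob_orbit z)) (alphabet (frob_orbit z))"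
  let ?c = "\<lambda>z. const_series (char_at \<xi> n z)"
  have hom: "calg_hom (sym_tensor Phi) (sym_fun (alphabet {1})) \<pi>"
    using \<pi> by (simp add: is_Pi_def)
  have one: "?c 1 * ?p 1 = sym_p n (alphabet {1})"
  proof -
    have "deg_Phi {1 :: 'a alg_closure} = 1" by (simp add: deg_Phi_def orbit_poly_def)
    moreover have "char_at \<xi> n 1 = 1" by (rule M_char_one[OF char_at_in_M_char[OF \<phi> \<xi> k n]])
    ultimately show ?thesis by (simp add: frob_orbit_one const_series_1)
  qed
  have \<pi>_id: "\<pi> (sym_p n (alphabet {1})) = sym_p n (alphabet {1})"
    using \<pi> sym_p_in_sym_fun by (auto simp: is_Pi_def)
  have p_in: "?p z \<in> sym_tensor Phi" if "z \<in> M_grp n" for z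
    using frob_orbit_in_Phi[OF that] sym_p_in_sym_fun by (rule sym_tensor.gen)
  have zero: "\<pi> (?c z * ?p z) = 0" if z: "z \<in> M_grp n" "z \<noteq> 1" for z
  proof -
    \<comment> \<open>Since z lies in its own orbit, that orbit is {1} only for z = 1.\<close>
    have "frob_orbit z \<in> Phi - {{1}}"
      using frob_orbit_in_Phi[OF z(1)] self_in_frob_orbit[of z] z(2) by auto
    moreover have "n div deg_Phi (frob_orbit z) \<ge> 1"
      using deg_Phi_frob_orbit[OF n1 z(1)] div_greater_zero_iff by (metis less_eq_Suc_le One_nat_def)
    ultimately have "\<pi> (?p z) = 0" using \<pi> by (auto simp: is_Pi_def)
    then show ?thesis
      using calg_homD(4)[OF hom sym_tensor.const p_in[OF z(1)]] by simp
  qed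
  have in_tensor: "?c z * ?p z \<in> sym_tensor Phi" if "z \<in> M_grp n" for z
    by (rule sym_tensor.mult[OF sym_tensor.const p_in[OF that]])
  have "T (sym_p k (alphabet \<phi>)) = const_series ((-1) ^ (n - 1)) * (\<Sum>z\<in>M_grp n. ?c z * ?p z)"
    using T \<phi> \<xi> k unfolding is_T_def Let_def n by blast
  moreover have "(\<Sum>z\<in>M_grp n. ?c z * ?p z) \<in> sym_tensor Phi \<and>
      \<pi> (\<Sum>z\<in>M_grp n. ?c z * ?p z) = (\<Sum>z\<in>M_grp n. \<pi> (?c z * ?p z))"
    by (rule calg_hom_sum[OF hom sym_tensor.const sym_tensor.add in_tensor])
  moreover have "(\<Sum>z\<in>M_grp n. \<pi> (?c z * ?p z)) = (\<Sum>z\<in>{1}. \<pi> (?c z * ?p z))"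
    by (rule sum.mono_neutral_right[OF finite_M_grp[OF n1]]) (use one_in_M_grp zero in auto)
  ultimately show ?thesis
    by (simp add: one \<pi>_id calg_homD(2,4)[OF hom] sym_tensor.const)
qed

text \<open>The plethysm raises the index from k to n, \<omega> supplies the sign, and renaming
  moves the result to the alphabet of x - 1.\<close>

lemma change_vars_omega_rho_sym_p:
  fixes \<rho> :: "'a :: finite_field Y_series \<Rightarrow> nat mv_series"
  assumes \<rho>: "is_rho \<rho>" and \<omega>: "is_omega \<omega>" and \<phi>: "\<phi> \<in> Theta" and k: "k \<ge> 1"
    and n: "n = k * deg_Theta \<phi>"
  shows "(change_vars (\<omega> (\<rho> (sym_p k (alphabet \<phi>)))) :: 'a X_series) =
    const_series ((-1) ^ (n - 1)) * sym_p n (alphabet {1})"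
proof -
  have d: "deg_Theta \<phi> \<ge> 1" by (rule Theta_orbit(1)[OF \<phi>])
  have n1: "n \<ge> 1" using k d by (simp add: n)
  have "\<rho> (sym_p k (alphabet \<phi>)) = sym_p n UNIV"
    unfolding n
  proof (rule calg_hom_sym_p_of_sym_h[OF _ _ _ _ _ d _ k])
    show "calg_hom (sym_tensor Theta) (sym_fun UNIV) \<rho>" using \<rho> by (simp add: is_rho_def)
    show "\<rho> (sym_h a (alphabet \<phi>)) = power_vars (deg_Theta \<phi>) (sym_h a UNIV)" for a
      using \<rho> \<phi> by (simp add: is_rho_def)
  qed (use \<phi> in \<open>auto intro: sym_tensor.intros\<close>)
  moreover have "\<omega> (sym_p n UNIV) = const_series ((-1) ^ (n - 1)) * sym_p n UNIV"
    by (rule omega_sym_p[OF _ _ n1]) (use \<omega> in \<open>auto simp: is_omega_def\<close>)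
  moreover have inj: "inj (\<lambda>i :: nat. ({1 :: 'a alg_closure}, i))" by (simp add: inj_def)
  moreover have "range (\<lambda>i :: nat. ({1 :: 'a alg_closure}, i)) = alphabet {1}"
    by (auto simp: alphabet_def)
  ultimately show ?thesis
    by (simp add: change_vars_def rename_vars_mult[OF inj] rename_vars_const[OF inj] rename_vars_sym_p[OF inj])
qed

theorem theorem3p16:
  fixes T :: "'a :: finite_field Y_series \<Rightarrow> 'a X_series"
    and \<rho> :: "'a Y_series \<Rightarrow> nat mv_series"
    and \<pi> :: "'a X_series \<Rightarrow> 'a X_series"
    and \<omega> :: "nat mv_series \<Rightarrow> nat mv_series"
  assumes "is_T T" and "is_rho \<rho>" and "is_Pi \<pi>" and "is_omega \<omega>"
  shows "\<forall>u\<in>sym_tensor Theta. (\<pi> \<circ> T) u = (change_vars \<circ> \<omega> \<circ> \<rho>) u"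
proof -
  let ?L = "\<lambda>u. \<pi> (T u)" and ?R = "\<lambda>u. change_vars (\<omega> (\<rho> u)) :: 'a X_series"
  let ?A = "sym_tensor Theta :: 'a Y_series set"
  \<comment> \<open>The set of agreement is a subalgebra containing all power sums, hence each
    \<Lambda>(Y^\<phi>), and these generate the tensor product. Membership in \<open>?A\<close> is
    part of it because the homomorphism laws hold only there.\<close>
  let ?E = "{u \<in> ?A. ?L u = ?R u}"
  have T: "calg_hom ?A (sym_tensor Phi) T" and \<rho>: "calg_hom ?A (sym_fun UNIV) \<rho>"
    and \<pi>: "calg_hom (sym_tensor Phi) (sym_fun (alphabet {1})) \<pi>"
    and \<omega>: "calg_hom (sym_fun UNIV) (sym_fun UNIV) \<omega>"
    using assms by (simp_all add: is_T_def is_rho_def is_Pi_def is_omega_def)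
  have inj: "inj (\<lambda>i :: nat. ({1 :: 'a alg_closure}, i))" by (simp add: inj_def)
  note hom = calg_homD[OF T] calg_homD[OF \<rho>] calg_homD[OF \<pi>] calg_homD[OF \<omega>]
    rename_vars_add[OF inj] rename_vars_mult[OF inj] rename_vars_const[OF inj]
  have const: "const_series c \<in> ?E" for c
    by (simp add: sym_tensor.const change_vars_def hom)
  have add: "f + g \<in> ?E" if "f \<in> ?E" "g \<in> ?E" for f g
    using that by (simp add: sym_tensor.add change_vars_def hom)
  have mult: "f * g \<in> ?E" if "f \<in> ?E" "g \<in> ?E" for f g
    using that by (simp add: sym_tensor.mult change_vars_def hom)
  have gen: "f \<in> ?E" if \<phi>: "\<phi> \<in> Theta" and f: "f \<in> sym_fun (alphabet \<phi>)" for \<phi> f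
    using f const _ add mult
  proof (rule sym_fun_power_sum_induct)
    fix k :: nat assume k: "k \<ge> 1"
    have "sym_p k (alphabet \<phi>) \<in> ?A"
      by (rule sym_tensor.gen[OF \<phi> sym_p_in_sym_fun])
    then show "sym_p k (alphabet \<phi>) \<in> ?E"
      using Pi_T_sym_p[OF assms(1,3) \<phi> k refl] change_vars_omega_rho_sym_p[OF assms(2,4) \<phi> k refl]
      by simp
  qed
  have "u \<in> ?E" if "u \<in> ?A" for u
    using that by induction (rule const gen add mult; assumption)+
  then show ?thesis by simp
qed

end
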